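(* Let $X$ be a compact metric space, let $Y=\{1,\dots,d\}^{\mathbb{N}}$ with shift $\sigma$, and let $\mu$ be a Borel probability measure on $X$. Let $C(X,Y)$ be the set of continuous functions from $X\times Y$ to $\mathbb{R}_+$ with the uniform norm. Then the set of functions $c\in C(X,Y)$ having a unique optimal plan in $\Pi(\mu,\sigma)$ is generic in $C(X,Y)$. The same is true for the Banach space $H(X,Y)$ of Lipschitz functions on $X\times Y$ with the usual norm: the set of $c\in H(X,Y)$ having a unique optimal plan in $\Pi(\mu,\sigma)$ is generic in $H(X,Y)$.
   Context: The shift is $\sigma(y_0,y_1,y_2,\dots)=(y_1,y_2,\dots)$ on $Y$. $\Pi(\mu,\sigma)$ is the set of Borel probability measures $\pi$ on $X\times Y$ whose $X$-marginal is $\mu$ and whose $Y$-marginal is a $\sigma$-invariant probability measure. An optimal plan for $c$ in $\Pi(\mu,\sigma)$ is a $\pi\in\Pi(\mu,\sigma)$ with $\int c\,d\pi=\inf_{\pi'\in\Pi(\mu,\sigma)}\int c\,d\pi'$. $\mathbb{R}_+=[0,+\infty)$. A subset is generic if it contains a countable intersection of open dense sets. $H(X,Y)$ is the space of Lipschitz functions $c:X\times Y\to\mathbb{R}$ with norm $\|c\|_\infty+\mathrm{Lip}(c)$, where $\mathrm{Lip}(c)$ is the least Lipschitz constant. $Y$ carries the usual metric $d(y,y')=\lambda^{\min\{k:\,y_k\ne y'_k\}}$ for $y\neq y'$ and $d(y,y)=0$, with a fixed $\lambda\in(0,1)$, and $X\times Y$ carries the sum of the two metrics. *)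

theory Defs
  imports "HOL-Probability.Probability"
begin

text \<open>
  The sequence space is the type \<^typ>\<open>nat \<Rightarrow> 'd\<close> over a finite discrete
  alphabet, with the product topology. The real parameter \<open>l\<close> is the
  contraction rate of the sequence metric.
\<close>

definition shift :: "(nat \<Rightarrow> 'd) \<Rightarrow> (nat \<Rightarrow> 'd)" where
  "shift y = (\<lambda>n. y (Suc n))"

definition seq_dist :: "real \<Rightarrow> (nat \<Rightarrow> 'd) \<Rightarrow> (nat \<Rightarrow> 'd) \<Rightarrow> real" where
  "seq_dist l y y' = (if y = y' then 0 else l ^ (LEAST k. y k \<noteq> y' k))"

definition sum_dist ::
  "real \<Rightarrow> 'x::metric_space \<times> (nat \<Rightarrow> 'd) \<Rightarrow> 'x \<times> (nat \<Rightarrow> 'd) \<Rightarrow> real" where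
  "sum_dist l p q = dist (fst p) (fst q) + seq_dist l (snd p) (snd q)"

text \<open>Measures carry their sigma-algebra, so Borel measures are those with \<open>sets\<close> Borel.\<close>

definition invariant_plans ::
  "'x::metric_space measure \<Rightarrow>
    ('x \<times> (nat \<Rightarrow> 'd::{finite,discrete_topology})) measure set" where
  "invariant_plans \<mu> = {\<pi>. sets \<pi> = sets borel \<and> prob_space \<pi> \<and>
     distr \<pi> borel fst = \<mu> \<and>
     distr (distr \<pi> borel snd) borel shift = distr \<pi> borel snd}"

definition optimal_plan ::
  "'x::metric_space measure \<Rightarrow> ('x \<times> (nat \<Rightarrow> 'd::{finite,discrete_topology}) \<Rightarrow> real) \<Rightarrow>
    ('x \<times> (nat \<Rightarrow> 'd)) measure \<Rightarrow> bool" where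
  "optimal_plan \<mu> c \<pi> \<longleftrightarrow> \<pi> \<in> invariant_plans \<mu> \<and>
     integral\<^sup>L \<pi> c = (INF \<pi>'\<in>invariant_plans \<mu>. integral\<^sup>L \<pi>' c)"

definition generic_in :: "'a topology \<Rightarrow> 'a set \<Rightarrow> bool" where
  "generic_in T S \<longleftrightarrow> S \<subseteq> topspace T \<and>
     (\<exists>U :: nat \<Rightarrow> 'a set. (\<forall>n. openin T (U n) \<and> T closure_of U n = topspace T) \<and>
       (\<Inter>n. U n) \<subseteq> S)"

text \<open>
  For compact \<open>X\<close> the product is compact, so \<open>\<Rightarrow>\<^sub>C\<close>, the type of bounded continuous
  functions with the uniform norm, contains all continuous functions
  (lemma \<open>continuous_in_bcontfun\<close>).
\<close>

definition nonneg_cont ::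
  "(('x::metric_space \<times> (nat \<Rightarrow> 'd::{finite,discrete_topology})) \<Rightarrow>\<^sub>C real) set" where
  "nonneg_cont = {c. \<forall>p. 0 \<le> apply_bcontfun c p}"

definition lip_bounds ::
  "real \<Rightarrow> ('x::metric_space \<times> (nat \<Rightarrow> 'd) \<Rightarrow> real) \<Rightarrow> real set" where
  "lip_bounds l c = {L. 0 \<le> L \<and> (\<forall>p q. \<bar>c p - c q\<bar> \<le> L * sum_dist l p q)}"

definition lip_funs :: "real \<Rightarrow> ('x::metric_space \<times> (nat \<Rightarrow> 'd) \<Rightarrow> real) set" where
  "lip_funs l = {c. lip_bounds l c \<noteq> {}}"

definition Lip :: "real \<Rightarrow> ('x::metric_space \<times> (nat \<Rightarrow> 'd) \<Rightarrow> real) \<Rightarrow> real" where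
  "Lip l c = Inf (lip_bounds l c)"

definition lip_norm :: "real \<Rightarrow> ('x::metric_space \<times> (nat \<Rightarrow> 'd) \<Rightarrow> real) \<Rightarrow> real" where
  "lip_norm l c = (SUP p. \<bar>c p\<bar>) + Lip l c"

text \<open>
  The locale \<^locale>\<open>Metric_space\<close> requires the distance to be nonnegative on the whole type;
  off \<^term>\<open>lip_funs l\<close>, where the norm is meaningless, the distance is set to 0.
\<close>

definition lip_dist :: "real \<Rightarrow> ('x::metric_space \<times> (nat \<Rightarrow> 'd) \<Rightarrow> real) \<Rightarrow>
    ('x \<times> (nat \<Rightarrow> 'd) \<Rightarrow> real) \<Rightarrow> real" where
  "lip_dist l c c' =
    (if c \<in> lip_funs l \<and> c' \<in> lip_funs l then lip_norm l (\<lambda>p. c p - c' p) else 0)"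

definition lip_topology :: "real \<Rightarrow> ('x::metric_space \<times> (nat \<Rightarrow> 'd) \<Rightarrow> real) topology" where
  "lip_topology l = Metric_space.mtopology (lip_funs l) (lip_dist l)"


section \<open>Consistency of the definitions with the library notions\<close>

lemma seq_dist_nonneg: "0 < l \<Longrightarrow> 0 \<le> seq_dist l y y'"
  by (simp add: seq_dist_def)

lemma seq_dist_commute: "seq_dist l y y' = seq_dist l y' y"
  by (simp add: seq_dist_def eq_commute)

lemma seq_dist_eq_0: "0 < l \<Longrightarrow> seq_dist l y y' = 0 \<longleftrightarrow> y = y'"
  by (simp add: seq_dist_def)

lemma seq_dist_le_1: "0 < l \<Longrightarrow> l < 1 \<Longrightarrow> seq_dist l y y' \<le> 1"
  by (simp add: seq_dist_def power_le_one)

lemma seq_dist_less_imp_eq: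
  assumes "0 < l" "l < 1" "seq_dist l y y' < l ^ n" "k \<le> n"
  shows "y k = y' k"
proof (rule ccontr)
  assume k: "y k \<noteq> y' k"
  then have "(LEAST k. y k \<noteq> y' k) \<le> n"
    using Least_le[of "\<lambda>k. y k \<noteq> y' k" k] assms(4) by simp
  then have "l ^ n \<le> l ^ (LEAST k. y k \<noteq> y' k)"
    using assms(1,2) by (intro power_decreasing) auto
  then show False using k assms(3) by (auto simp: seq_dist_def split: if_splits)
qed

lemma seq_dist_le:
  assumes "0 < l" "l < 1" "\<And>k. k < n \<Longrightarrow> y k = y' k"
  shows "seq_dist l y y' \<le> l ^ n"
proof (cases "y = y'")
  case False
  then obtain j where "y j \<noteq> y' j" by blast
  then have "y (LEAST k. y k \<noteq> y' k) \<noteq> y' (LEAST k. y k \<noteq> y' k)" by (rule LeastI)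
  then have "n \<le> (LEAST k. y k \<noteq> y' k)" using assms(3) leI by blast
  then show ?thesis using False assms by (auto simp: seq_dist_def intro: power_decreasing)
qed (use assms in \<open>simp add: seq_dist_def\<close>)

lemma seq_dist_ultra:
  assumes "0 < l" "l < 1"
  shows "seq_dist l x z \<le> max (seq_dist l x y) (seq_dist l y z)"
proof (cases "x = z")
  case False
  define n where "n = (LEAST k. x k \<noteq> z k)"
  from False obtain j where "x j \<noteq> z j" by blast
  then have n: "x n \<noteq> z n" unfolding n_def by (rule LeastI)
  have d: "seq_dist l x z = l ^ n" using False by (simp add: seq_dist_def n_def)
  show ?thesis
  proof (rule ccontr)
    assume "\<not> ?thesis"
    then have "x n = y n" "y n = z n"
      using d seq_dist_less_imp_eq[OF assms] by (metis le_refl max_less_iff_conj not_le)+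
    with n show False by simp
  qed
qed (use assms in \<open>simp add: seq_dist_def le_max_iff_disj\<close>)

lemma Metric_space_sum_dist:
  assumes "0 < l" "l < 1"
  shows "Metric_space UNIV (sum_dist l)"
proof
  fix p q r :: "'a \<times> (nat \<Rightarrow> 'b)"
  show "0 \<le> sum_dist l p q"
    using assms by (simp add: sum_dist_def seq_dist_nonneg)
  show "sum_dist l p q = sum_dist l q p"
    by (simp add: sum_dist_def seq_dist_commute dist_commute)
  show "sum_dist l p q = 0 \<longleftrightarrow> p = q"
    using assms seq_dist_eq_0[of l "snd p" "snd q"] seq_dist_nonneg[of l "snd p" "snd q"]
    by (auto simp: sum_dist_def prod_eq_iff add_nonneg_eq_0_iff)
  show "sum_dist l p r \<le> sum_dist l p q + sum_dist l q r"
    using seq_dist_ultra[OF assms, of "snd p" "snd r" "snd q"] dist_triangle[of "fst p" "fst r" "fst q"]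
      seq_dist_nonneg[OF assms(1), of "snd p" "snd q"] seq_dist_nonneg[OF assms(1), of "snd q" "snd r"]
    by (simp add: sum_dist_def)
qed

lemma open_cylinder:
  fixes y :: "nat \<Rightarrow> 'd::discrete_topology"
  shows "open {z. \<forall>k<n. z k = y k}"
proof -
  have "open ((\<lambda>z. z k) -` {y k} :: (nat \<Rightarrow> 'd) set)" for k
    by (rule open_vimage) (auto intro: discrete_topology_class.open_discrete)
  then have "open (\<Inter>k\<in>{..<n}. (\<lambda>z. z k) -` {y k} :: (nat \<Rightarrow> 'd) set)"
    by (intro open_INT) auto
  moreover have "(\<Inter>k\<in>{..<n}. (\<lambda>z. z k) -` {y k}) = {z. \<forall>k<n. z k = y k}" by auto
  ultimately show ?thesis by simp
qed

lemma open_contains_cylinder: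
  fixes y :: "nat \<Rightarrow> 'd::discrete_topology"
  assumes "open U" "y \<in> U"
  obtains n where "{z. \<forall>k<n. z k = y k} \<subseteq> U"
proof -
  obtain X where X: "y \<in> Pi\<^sub>E UNIV X" "finite {i. X i \<noteq> UNIV}" "Pi\<^sub>E UNIV X \<subseteq> U"
    using product_topology_open_contains_basis[of "\<lambda>_. euclidean" UNIV U y] assms
    by (auto simp: open_fun_def)
  from X(2) obtain n where "{i. X i \<noteq> UNIV} \<subseteq> {..<n}"
    using finite_nat_iff_bounded by blast
  then have n: "X i = UNIV" if "i \<ge> n" for i using that by (auto simp: subset_eq)
  have "{z. \<forall>k<n. z k = y k} \<subseteq> U"
  proof
    fix z assume z: "z \<in> {z. \<forall>k<n. z k = y k}"
    have "z i \<in> X i" for i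
      using z X(1) n[of i] by (cases "i < n") (auto simp: PiE_iff)
    then show "z \<in> U" using X(3) by (auto simp: PiE_iff)
  qed
  then show ?thesis by (rule that)
qed

text \<open>The sum metric induces the topology of the product type, hence also its Borel sets.\<close>

lemma mtopology_sum_dist:
  assumes "0 < l" "l < 1"
  shows "Metric_space.mtopology UNIV (sum_dist l) =
    (euclidean :: ('x::metric_space \<times> (nat \<Rightarrow> 'd::discrete_topology)) topology)"
proof -
  interpret Metric_space UNIV "sum_dist l :: 'x \<times> (nat \<Rightarrow> 'd) \<Rightarrow> _"
    by (rule Metric_space_sum_dist[OF assms])
  have "(\<forall>p\<in>U. \<exists>r>0. mball p r \<subseteq> U) \<longleftrightarrow> open U" for U
  proof
    assume L: "\<forall>p\<in>U. \<exists>r>0. mball p r \<subseteq> U"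
    show "open U"
    proof (subst open_subopen, rule ballI)
      fix p assume "p \<in> U"
      then obtain r where r: "r > 0" "mball p r \<subseteq> U" using L by blast
      obtain n where n: "l ^ n < r / 2"
        using real_arch_pow_inv[of "r / 2" l] r assms by auto
      define V where "V = ball (fst p) (r / 2) \<times> {z. \<forall>k<n. z k = snd p k}"
      have "open V" unfolding V_def by (intro open_Times open_ball open_cylinder)
      moreover have "p \<in> V" using r by (auto simp: V_def mem_Times_iff)
      moreover have "V \<subseteq> mball p r"
      proof
        fix q assume q: "q \<in> V"
        then have "seq_dist l (snd p) (snd q) \<le> l ^ n"
          by (intro seq_dist_le assms) (auto simp: V_def)
        moreover have "dist (fst p) (fst q) < r / 2" using q by (auto simp: V_def)
        ultimately have "sum_dist l p q < r" using n unfolding sum_dist_def by linarith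
        then show "q \<in> mball p r" by simp
      qed
      ultimately show "\<exists>T. open T \<and> p \<in> T \<and> T \<subseteq> U" using r by blast
    qed
  next
    assume U: "open U"
    show "\<forall>p\<in>U. \<exists>r>0. mball p r \<subseteq> U"
    proof
      fix p assume "p \<in> U"
      then obtain A B where AB: "open A" "open B" "p \<in> A \<times> B" "A \<times> B \<subseteq> U"
        using open_prod_elim[OF U] by metis
      from AB obtain n where n: "{z. \<forall>k<n. z k = snd p k} \<subseteq> B"
        using open_contains_cylinder[of B "snd p"] by (auto simp: mem_Times_iff)
      from AB obtain e where e: "e > 0" "ball (fst p) e \<subseteq> A"
        using openE[of A "fst p"] by (auto simp: mem_Times_iff)
      have "mball p (min e (l ^ n)) \<subseteq> U"
      proof
        fix q assume "q \<in> mball p (min e (l ^ n))"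
        then have q: "sum_dist l p q < e" "sum_dist l p q < l ^ n" by auto
        have "dist (fst p) (fst q) < e"
          using q(1) seq_dist_nonneg[OF assms(1), of "snd p" "snd q"] by (simp add: sum_dist_def)
        then have "fst q \<in> A" using e by auto
        moreover have "seq_dist l (snd p) (snd q) < l ^ n"
          using q(2) zero_le_dist[of "fst p" "fst q"] unfolding sum_dist_def by linarith
        then have "snd p k = snd q k" if "k < n" for k
          using seq_dist_less_imp_eq[OF assms _ less_imp_le[OF that]] by blast
        then have "snd q \<in> {z. \<forall>k<n. z k = snd p k}" by simp
        then have "snd q \<in> B" using n by blast
        ultimately show "q \<in> U" using AB by (auto simp: mem_Times_iff)
      qed
      moreover have "0 < min e (l ^ n)" using e assms by simp
      ultimately show "\<exists>r>0. mball p r \<subseteq> U" by blast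
    qed
  qed
  then show ?thesis
    unfolding topology_eq openin_mtopology open_openin[symmetric] Ball_def by simp
qed

lemma compact_UNIV_seq: "compact (UNIV :: (nat \<Rightarrow> 'd::{finite,discrete_topology}) set)"
proof -
  have "compactin (product_topology (\<lambda>_. euclidean :: 'd topology) (UNIV :: nat set))
      (Pi\<^sub>E UNIV (\<lambda>_. UNIV))"
    unfolding compactin_PiE compactin_euclidean_iff
    by (simp add: finite_imp_compact)
  then show ?thesis
    unfolding euclidean_product_topology by simp
qed

lemma compact_UNIV_prod:
  assumes "compact (UNIV :: 'x::metric_space set)"
  shows "compact (UNIV :: ('x \<times> (nat \<Rightarrow> 'd::{finite,discrete_topology})) set)"
  using compact_Times[OF assms compact_UNIV_seq[where 'd='d]] by simp

lemma continuous_in_bcontfun: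
  fixes c :: "'x::metric_space \<times> (nat \<Rightarrow> 'd::{finite,discrete_topology}) \<Rightarrow> real"
  assumes "compact (UNIV :: 'x set)" "continuous_on UNIV c"
  shows "c \<in> bcontfun"
  using compact_continuous_image[OF assms(2) compact_UNIV_prod[OF assms(1)]] assms(2)
  unfolding bcontfun_def by (blast intro: compact_imp_bounded)

lemma Lip_in_lip_bounds:
  assumes "0 < l" "c \<in> lip_funs l"
  shows "Lip l c \<in> lip_bounds l c"
proof -
  have ne: "lip_bounds l c \<noteq> {}" using assms by (simp add: lip_funs_def)
  have "0 \<le> Lip l c"
    unfolding Lip_def using ne by (intro cInf_greatest) (auto simp: lip_bounds_def)
  moreover have "\<bar>c p - c q\<bar> \<le> Lip l c * sum_dist l p q" for p q
  proof (cases "sum_dist l p q = 0")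
    case True
    from ne obtain L where "\<bar>c p - c q\<bar> \<le> L * sum_dist l p q"
      unfolding lip_bounds_def by blast
    with True show ?thesis by simp
  next
    case False
    then have s: "sum_dist l p q > 0"
      using seq_dist_nonneg[OF assms(1), of "snd p" "snd q"] zero_le_dist[of "fst p" "fst q"]
      unfolding sum_dist_def by linarith
    have "\<bar>c p - c q\<bar> / sum_dist l p q \<le> L" if "L \<in> lip_bounds l c" for L
      using that s unfolding lip_bounds_def by (auto simp only: mem_Collect_eq divide_le_eq if_True)
    then have "\<bar>c p - c q\<bar> / sum_dist l p q \<le> Lip l c"
      unfolding Lip_def using ne by (rule cInf_greatest[rotated])
    then show ?thesis using s by (simp add: divide_le_eq)
  qed
  ultimately show ?thesis by (simp add: lip_bounds_def)
qed

lemma Lip_le: "L \<in> lip_bounds l c \<Longrightarrow> Lip l c \<le> L"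
  unfolding Lip_def by (rule cInf_lower) (auto simp: lip_bounds_def bdd_below_def)

lemma bdd_above_lip_fun:
  fixes c :: "'x::metric_space \<times> (nat \<Rightarrow> 'd) \<Rightarrow> real"
  assumes "0 < l" "l < 1" "compact (UNIV :: 'x set)" "c \<in> lip_funs l"
  shows "bdd_above (range (\<lambda>p. \<bar>c p\<bar>))"
proof -
  obtain L where L: "0 \<le> L" "\<And>p q. \<bar>c p - c q\<bar> \<le> L * sum_dist l p q"
    using assms by (auto simp: lip_funs_def lip_bounds_def)
  define p0 :: "'x \<times> (nat \<Rightarrow> 'd)" where "p0 = undefined"
  obtain R where R: "\<And>x. dist (fst p0) x \<le> R"
    using compact_imp_bounded[OF assms(3)] by (auto simp: bounded_any_center[of _ "fst p0"])
  have "\<bar>c p\<bar> \<le> \<bar>c p0\<bar> + L * (R + 1)" for p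
  proof -
    have "sum_dist l p0 p \<le> R + 1"
      using R[of "fst p"] seq_dist_le_1[OF assms(1,2), of "snd p0" "snd p"]
      by (simp add: sum_dist_def)
    then have "L * sum_dist l p0 p \<le> L * (R + 1)" using L(1) by (rule mult_left_mono)
    then show ?thesis using L(2)[of p0 p] by linarith
  qed
  then show ?thesis by (auto simp: bdd_above_def)
qed

lemma lip_bounds_add:
  assumes "L \<in> lip_bounds l c" "L' \<in> lip_bounds l c'"
  shows "L + L' \<in> lip_bounds l (\<lambda>p. c p + c' p)"
proof -
  have "\<bar>(c p + c' p) - (c q + c' q)\<bar> \<le> (L + L') * sum_dist l p q" for p q
  proof -
    have "\<bar>c p - c q\<bar> \<le> L * sum_dist l p q" "\<bar>c' p - c' q\<bar> \<le> L' * sum_dist l p q"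
      using assms unfolding lip_bounds_def by blast+
    then show ?thesis unfolding distrib_right by linarith
  qed
  then show ?thesis using assms by (simp add: lip_bounds_def)
qed

lemma lip_bounds_uminus: "lip_bounds l (\<lambda>p. - c p) = lip_bounds l c"
proof -
  have "\<bar>- c p + c q\<bar> = \<bar>c p - c q\<bar>" for p q by simp
  then show ?thesis by (simp add: lip_bounds_def)
qed

lemma lip_funs_diff:
  assumes "c \<in> lip_funs l" "c' \<in> lip_funs l"
  shows "(\<lambda>p. c p - c' p) \<in> lip_funs l"
proof -
  obtain L L' where "L \<in> lip_bounds l c" "L' \<in> lip_bounds l c'"
    using assms by (auto simp: lip_funs_def)
  then have "L + L' \<in> lip_bounds l (\<lambda>p. c p + - c' p)"
    by (intro lip_bounds_add) (simp_all only: lip_bounds_uminus)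
  then show ?thesis by (auto simp: lip_funs_def)
qed

lemma Metric_space_lip_funs:
  assumes "0 < l" "l < 1" "compact (UNIV :: 'x::metric_space set)"
  shows "Metric_space (lip_funs l :: ('x \<times> (nat \<Rightarrow> 'd) \<Rightarrow> real) set) (lip_dist l)"
proof -
  let ?S = "\<lambda>c :: 'x \<times> (nat \<Rightarrow> 'd) \<Rightarrow> real. SUP p. \<bar>c p\<bar>"
  have S_ge: "\<bar>c p\<bar> \<le> ?S c" if "c \<in> lip_funs l" for c p
    using bdd_above_lip_fun[OF assms that] by (intro cSUP_upper) auto
  have Lip_nonneg: "0 \<le> Lip l c" if "c \<in> lip_funs l" for c :: "'x \<times> (nat \<Rightarrow> 'd) \<Rightarrow> real"
    using Lip_in_lip_bounds[OF assms(1) that] by (simp add: lip_bounds_def)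
  have neg: "lip_norm l (\<lambda>p. c' p - c p) = lip_norm l (\<lambda>p. c p - c' p)"
    for c c' :: "'x \<times> (nat \<Rightarrow> 'd) \<Rightarrow> real"
  proof -
    have "Lip l (\<lambda>p. c' p - c p) = Lip l (\<lambda>p. c p - c' p)"
      using lip_bounds_uminus[of l "\<lambda>p. c p - c' p"] by (simp add: Lip_def)
    then show ?thesis by (simp add: lip_norm_def abs_minus_commute)
  qed
  have ge: "\<bar>c p\<bar> \<le> lip_norm l c" if "c \<in> lip_funs l" for c :: "'x \<times> (nat \<Rightarrow> 'd) \<Rightarrow> real" and p
    using S_ge[OF that, of p] Lip_nonneg[OF that] by (simp add: lip_norm_def)
  have nonneg: "0 \<le> lip_norm l c" if "c \<in> lip_funs l" for c :: "'x \<times> (nat \<Rightarrow> 'd) \<Rightarrow> real"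
    using ge[OF that, of undefined] by linarith
  have zero: "lip_norm l (\<lambda>_ :: 'x \<times> (nat \<Rightarrow> 'd). 0) = 0"
  proof -
    have b: "0 \<in> lip_bounds l (\<lambda>_ :: 'x \<times> (nat \<Rightarrow> 'd). 0)" by (simp add: lip_bounds_def)
    then have "Lip l (\<lambda>_ :: 'x \<times> (nat \<Rightarrow> 'd). 0) = 0"
      using Lip_le[OF b] Lip_nonneg[of "\<lambda>_. 0"] by (force simp: lip_funs_def)
    then show ?thesis by (simp add: lip_norm_def)
  qed
  have tri: "lip_norm l (\<lambda>p. c p + c' p) \<le> lip_norm l c + lip_norm l c'"
    if "c \<in> lip_funs l" "c' \<in> lip_funs l" for c c' :: "'x \<times> (nat \<Rightarrow> 'd) \<Rightarrow> real"
  proof -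
    have "Lip l (\<lambda>p. c p + c' p) \<le> Lip l c + Lip l c'"
      using that assms by (intro Lip_le lip_bounds_add Lip_in_lip_bounds)
    moreover have "?S (\<lambda>p. c p + c' p) \<le> ?S c + ?S c'"
    proof (rule cSUP_least)
      fix p
      show "\<bar>c p + c' p\<bar> \<le> ?S c + ?S c'"
        using S_ge[OF that(1), of p] S_ge[OF that(2), of p] by linarith
    qed simp
    ultimately show ?thesis by (simp add: lip_norm_def)
  qed
  show ?thesis
  proof
    fix a b c :: "'x \<times> (nat \<Rightarrow> 'd) \<Rightarrow> real"
    show "0 \<le> lip_dist l a b"
      using nonneg[OF lip_funs_diff[of a l b]] by (simp add: lip_dist_def)
    show "lip_dist l a b = lip_dist l b a"
      unfolding lip_dist_def using neg[of a b] by auto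
    show "a \<in> lip_funs l \<Longrightarrow> b \<in> lip_funs l \<Longrightarrow> lip_dist l a b = 0 \<longleftrightarrow> a = b"
    proof
      assume ab: "a \<in> lip_funs l" "b \<in> lip_funs l" and *: "lip_dist l a b = 0"
      have "a p = b p" for p
        using ge[OF lip_funs_diff[OF ab], of p] * ab by (simp add: lip_dist_def)
      then show "a = b" by blast
    qed (simp add: lip_dist_def zero)
    show "a \<in> lip_funs l \<Longrightarrow> b \<in> lip_funs l \<Longrightarrow> c \<in> lip_funs l \<Longrightarrow>
        lip_dist l a c \<le> lip_dist l a b + lip_dist l b c"
      using tri[OF lip_funs_diff[of a l b] lip_funs_diff[of b l c]] by (simp add: lip_dist_def)
  qed
qed

end

theory Submission
  imports Defs
begin

section \<open>Random infinite words\<close>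

text \<open>For a fixed plan the integral of the cost is linear in the cost, and for a fixed
  continuous cost it is weakly continuous in the plan. The plans form a nonempty weakly sequentially
  compact set \<open>K\<close> of probability measures, so every continuous cost has a minimizer in
  \<open>K\<close>.

  Let e_0, e_1, ... be a sequence of Lipschitz functions with values in [0,1] whose integrals
  determine a probability measure. A cost c has only one minimizer once, for every n, the integrals
  of e_n over the near-minimizers of c have arbitrarily small spread. For fixed n and fixed
  tolerance this is an open condition on c, so it remains to see that it is dense. The value of the
  minimum for c + t * e_n is a concave function of t whose slopes are integrals of e_n over
  minimizers, hence lie in [0,1]. Its slope can therefore jump by a given amount at finitely many t
  only, and some arbitrarily small t >= 0 is good. The proof runs a discrete form of this argument
  with near-minimizers on a grid of values of t (\<open>V_dense\<close> in
  \<open>generic_unique_minimizer\<close>).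

  The last theorem is stated for an abstract metric space of costs. It asks only that small
  nonnegative multiples of a Lipschitz function with values in [0,1] may be added to a cost, which
  holds in the cone of nonnegative continuous functions as well as in the Lipschitz space. Its two
  inputs are \<open>countable_determining_family\<close> and the compactness theorem
  \<open>weakly_convergent_subsequence\<close>, which rests on Kolmogorov's extension theorem in the
  form \<open>word_pmfs_extension\<close>. The shift enters through its fixed points, which make
  \<open>K\<close> nonempty (\<open>invariant_plans_nonempty\<close>), and through its continuity,
  which makes invariance pass to weak limits (\<open>invariant_plans_weakly_closed\<close>).\<close>

lemma map_pmf_take_consistent:
  fixes R :: "nat \<Rightarrow> 'a list pmf"
  assumes "\<And>n. map_pmf (take n) (R (Suc n)) = R n" and "n \<le> m"
  shows "map_pmf (take n) (R m) = R n"
  using assms(2)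
proof (induction m rule: dec_induct)
  case base
  \<comment> \<open>Word lengths are not controlled here, so \<open>take n\<close> need not be the
    identity on \<open>R n\<close>. But \<open>R n\<close> is itself an image under
    \<open>take n\<close>, which is idempotent.\<close>
  have "map_pmf (take n) (R n) = map_pmf (take n) (map_pmf (take n) (R (Suc n)))"
    by (simp only: assms(1))
  also have "\<dots> = R n"
    unfolding pmf.map_comp by (simp add: o_def assms(1))
  finally show ?case .
next
  case (step m)
  have "map_pmf (take n) (R (Suc m)) = map_pmf (take n) (map_pmf (take m) (R (Suc m)))"
    using step(1) by (simp add: pmf.map_comp o_def min_absorb1)
  then show ?case using assms(1) step.IH by simp
qed

lemma measurable_map_upt:
  fixes f :: "nat \<Rightarrow> 'a \<Rightarrow> 'b::countable"
  assumes "\<And>i. i < n \<Longrightarrow> f i \<in> measurable M (count_space UNIV)"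
  shows "(\<lambda>x. map (\<lambda>i. f i x) [0..<n]) \<in> measurable M (count_space UNIV)"
  using assms
proof (induction n)
  case (Suc n)
  then have "(\<lambda>x. map (\<lambda>i. f i x) [0..<n]) \<in> measurable M (count_space UNIV)"
    and "f n \<in> measurable M (count_space UNIV)" by simp_all
  then have "(\<lambda>x. map (\<lambda>i. f i x) [0..<n] @ [f n x]) \<in> measurable M (count_space UNIV)"
    by measurable
  then show ?case by simp
qed simp

text \<open>Kolmogorov's extension theorem for words. The letters are embedded in the reals, so that
  \<open>polish_projective\<close> applies to the Borel sigma-algebras, and are recovered from the
  projective limit by the coordinatewise floor \<open>\<phi>\<close>. Since \<open>R\<close> gives
  laws of prefixes only, the law over a finite set of positions is read off from a prefix covering
  that set.\<close>

lemma word_pmfs_extension: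
  fixes R :: "nat \<Rightarrow> nat list pmf"
  assumes len: "\<And>n w. w \<in> set_pmf (R n) \<Longrightarrow> length w = n"
    and cons: "\<And>n. map_pmf (take n) (R (Suc n)) = R n"
  obtains \<nu> :: "(nat \<Rightarrow> nat) measure" where "prob_space \<nu>"
    and "\<And>i. (\<lambda>a. a i) \<in> measurable \<nu> (count_space UNIV)"
    and "\<And>n. distr \<nu> (count_space UNIV) (\<lambda>a. map a [0..<n]) = measure_pmf (R n)"
proof -
  \<comment> \<open>The least length of a prefix that contains all positions in \<open>J\<close>;
    inserting 0 gives the empty set length 0.\<close>
  define N where "N J = Max (insert 0 (Suc ` J))" for J :: "nat set"
  have N_less: "i < N J" if "i \<in> J" "finite J" for i J
    using that unfolding N_def by (intro Suc_le_lessD Max_ge) auto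
  have N_mono: "N J \<le> N H" if "J \<subseteq> H" "finite H" for J H
    using that unfolding N_def by (intro Max_mono) (auto intro: finite_subset)
  have N_lessThan: "N {..<n} = n" for n
  proof (rule antisym)
    show "N {..<n} \<le> n" unfolding N_def by (subst Max_le_iff) auto
    show "n \<le> N {..<n}" by (cases n) (use N_less[of "n - 1" "{..<n}"] in auto)
  qed
  define B where "B = (\<lambda>_ :: nat. borel :: real measure)"
  define P where "P J = distr (measure_pmf (R (N J))) (PiM J B) (\<lambda>w. \<lambda>i\<in>J. real (w ! i))"
    for J :: "nat set"
  have P_meas: "(\<lambda>w. \<lambda>i\<in>J. real (w ! i)) \<in> measurable (measure_pmf q) (PiM J B)" for q J
    by (simp add: B_def space_PiM)
  interpret polish_projective UNIV P
  proof (intro polish_projective.intro projective_family.intro)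

    fix J H :: "nat set" assume JH: "J \<subseteq> H" "finite H"
    have "distr (P H) (PiM J B) (\<lambda>f. restrict f J) =
        distr (measure_pmf (R (N H))) (PiM J B) ((\<lambda>f. restrict f J) \<circ> (\<lambda>w. \<lambda>i\<in>H. real (w ! i)))"
      unfolding P_def using JH by (intro distr_distr P_meas measurable_restrict_subset) auto
    also have "\<dots> = distr (measure_pmf (R (N H))) (PiM J B)
        ((\<lambda>w. \<lambda>i\<in>J. real (w ! i)) \<circ> take (N J))"
    proof (intro distr_cong refl)
      fix w
      show "((\<lambda>f. restrict f J) \<circ> (\<lambda>w. \<lambda>i\<in>H. real (w ! i))) w =
          ((\<lambda>w. \<lambda>i\<in>J. real (w ! i)) \<circ> take (N J)) w"
        using JH N_less[OF _ finite_subset[OF JH]] by (auto simp: restrict_def fun_eq_iff)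
    qed
    also have "\<dots> = distr (distr (measure_pmf (R (N H))) (count_space UNIV) (take (N J)))
        (PiM J B) (\<lambda>w. \<lambda>i\<in>J. real (w ! i))"
      by (intro distr_distr[symmetric]) (auto simp: B_def space_PiM)
    also have "distr (measure_pmf (R (N H))) (count_space UNIV) (take (N J)) =
        measure_pmf (R (N J))"
      using map_pmf_take_consistent[OF cons N_mono[OF JH]] by (metis map_pmf_rep_eq)
    finally show "P J = distr (P H) (PiM J (\<lambda>_. borel)) (\<lambda>f. restrict f J)"
      by (simp only: P_def B_def)
  next
    fix J :: "nat set"
    show "prob_space (P J)"
      unfolding P_def by (intro prob_space.prob_space_distr P_meas prob_space_measure_pmf)
  qed
  have measurable_lim: "measurable lim L = measurable (PiM UNIV B) L" for L :: "'z measure"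
    unfolding B_def by (intro measurable_cong_sets) auto
  have lim_restrict: "distr lim (PiM J B) (\<lambda>a. restrict a J) = P J" if "finite J" for J
  proof (rule measure_eqI)
    fix X assume "X \<in> sets (distr lim (PiM J B) (\<lambda>a. restrict a J))"
    then have X: "X \<in> sets (PiM J B)" by simp
    have "(\<lambda>a. restrict a J) -` X \<inter> space lim = emb UNIV J X"
      by (simp add: prod_emb_def B_def space_PiM)
    moreover have "(\<lambda>a. restrict a J) \<in> measurable lim (PiM J B)"
      unfolding measurable_lim by (rule measurable_restrict_subset) simp
    ultimately show "emeasure (distr lim (PiM J B) (\<lambda>a. restrict a J)) X = emeasure (P J) X"
      using X that by (simp add: emeasure_distr emeasure_lim_emb B_def)
  qed (use that in \<open>simp add: sets_P B_def\<close>)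
  define C where "C = (\<lambda>_ :: nat. count_space (UNIV :: nat set))"
  define \<phi> where "\<phi> a i = nat \<lfloor>a i :: real\<rfloor>" for a and i :: nat
  have \<phi>: "\<phi> \<in> measurable lim (PiM UNIV C)"
    unfolding measurable_lim unfolding B_def C_def \<phi>_def
    by (rule measurable_PiM_single') (auto simp: space_PiM)
  define \<nu> where "\<nu> = distr lim (PiM UNIV C) \<phi>"
  have coord: "(\<lambda>a. a i) \<in> measurable \<nu> (count_space UNIV)" for i
    unfolding \<nu>_def C_def by simp
  show thesis
  proof
    show "prob_space \<nu>" unfolding \<nu>_def by (rule P.prob_space_distr[OF \<phi>])
    show "(\<lambda>a. a i) \<in> measurable \<nu> (count_space UNIV)" for i by (rule coord)
    show "distr \<nu> (count_space UNIV) (\<lambda>a. map a [0..<n]) = measure_pmf (R n)" for n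
    proof -
      have floors: "(\<lambda>a. map (\<phi> a) [0..<n]) \<in> measurable (PiM {..<n} B) (count_space UNIV)"
      proof -
        \<comment> \<open>In \<open>PiM {..<n} B\<close> only coordinates below \<open>n\<close> are
          available. Padding with 0 reaches the full product without changing the word of length
          \<open>n\<close>.\<close>
        have "(\<lambda>a. \<lambda>i. if i < n then \<phi> a i else 0) \<in> measurable (PiM {..<n} B) (PiM UNIV C)"
        proof (rule measurable_PiM_single')
          show "(\<lambda>a. if i < n then \<phi> a i else 0) \<in> measurable (PiM {..<n} B) (C i)" for i
          proof (cases "i < n")
            case True
            then have "(\<lambda>a. a i) \<in> borel_measurable (PiM {..<n} B)"
              using measurable_component_singleton[of i "{..<n}" B] by (simp add: B_def)
            then show ?thesis using True unfolding \<phi>_def C_def by simp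
          qed (simp add: C_def)
        qed (simp add: space_PiM C_def)
        moreover have "(\<lambda>a. map a [0..<n]) \<in> measurable (PiM UNIV C) (count_space UNIV)"
          by (rule measurable_map_upt) (simp add: C_def)
        ultimately have "(\<lambda>a. map (\<lambda>i. if i < n then \<phi> a i else 0) [0..<n]) \<in>
            measurable (PiM {..<n} B) (count_space UNIV)"
          by (rule measurable_compose)
        moreover have "map (\<lambda>i. if i < n then \<phi> a i else 0) [0..<n] = map (\<phi> a) [0..<n]" for a
          by auto
        ultimately show ?thesis by simp
      qed
      have "distr \<nu> (count_space UNIV) (\<lambda>a. map a [0..<n]) =
          distr lim (count_space UNIV) ((\<lambda>a. map a [0..<n]) \<circ> \<phi>)"
        unfolding \<nu>_def by (intro distr_distr \<phi> measurable_map_upt) (simp add: C_def)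
      also have "\<dots> = distr lim (count_space UNIV) ((\<lambda>a. map (\<phi> a) [0..<n]) \<circ> (\<lambda>a. restrict a {..<n}))"
        by (intro distr_cong) (auto simp: \<phi>_def)
      also have "\<dots> = distr (distr lim (PiM {..<n} B) (\<lambda>a. restrict a {..<n})) (count_space UNIV)
          (\<lambda>a. map (\<phi> a) [0..<n])"
        by (intro distr_distr[symmetric] floors)
          (auto simp: measurable_lim intro: measurable_restrict_subset)
      also have "\<dots> = distr (measure_pmf (R n)) (count_space UNIV)
          ((\<lambda>a. map (\<phi> a) [0..<n]) \<circ> (\<lambda>w. \<lambda>i\<in>{..<n}. real (w ! i)))"
        unfolding lim_restrict[OF finite_lessThan] P_def N_lessThan
        by (intro distr_distr floors P_meas)
      also have "\<dots> = measure_pmf (map_pmf (\<lambda>w. map ((!) w) [0..<n]) (R n))"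
        unfolding map_pmf_rep_eq by (intro distr_cong) (auto simp: \<phi>_def)
      also have "map_pmf (\<lambda>w. map ((!) w) [0..<n]) (R n) = map_pmf id (R n)"
      proof (rule map_pmf_cong[OF refl])
        fix w assume "w \<in> set_pmf (R n)"
        then show "map ((!) w) [0..<n] = id w" using len[of w n] map_nth[of w] by simp
      qed
      finally show ?thesis by simp
    qed
  qed
qed

section \<open>Weak sequential compactness\<close>

lemma (in prob_space) abs_integral_diff_le:
  fixes f g :: "'a \<Rightarrow> real"
  assumes "integrable M f" "integrable M g" and "AE x in M. \<bar>f x - g x\<bar> \<le> e"
  shows "\<bar>integral\<^sup>L M f - integral\<^sup>L M g\<bar> \<le> e"
proof -
  have "\<bar>\<integral>x. f x - g x \<partial>M\<bar> \<le> (\<integral>x. \<bar>f x - g x\<bar> \<partial>M)"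
    by (rule integral_abs_bound)
  also have "\<dots> \<le> e"
    using assms by (intro integral_le_const integrable_abs Bochner_Integration.integrable_diff)
  finally show ?thesis using assms by simp
qed

text \<open>The metric is a parameter and not the \<open>dist\<close> of a type class, because
  Lipschitz constants on the product are measured by \<open>sum_dist l\<close>. Identifying its
  topology with that of the type lets \<open>borel\<close> and \<open>continuous_on UNIV\<close>
  refer to the same structure.\<close>

locale compact_metric_type = Metric_space UNIV d for d :: "'z::topological_space \<Rightarrow> 'z \<Rightarrow> real" +
  assumes mtopology_euclidean: "mtopology = euclidean"
    and compact_UNIV: "compact (UNIV :: 'z set)"
begin

lemma open_mball: "open (mball z e)"
  using openin_mball[of z e] by (simp add: mtopology_euclidean)

lemma lipschitz_continuous:
  fixes f :: "'z \<Rightarrow> real"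
  assumes "\<And>z w. \<bar>f z - f w\<bar> \<le> L * d z w"
  shows "continuous_on UNIV f"
proof -
  have "Lipschitz_continuous_map Self euclidean_metric f"
    unfolding Lipschitz_continuous_map_def using assms by (auto simp: dist_real_def)
  then have "continuous_map (mtopology_of Self) (mtopology_of euclidean_metric) f"
    by (intro uniformly_continuous_imp_continuous_map Lipschitz_imp_uniformly_continuous_map)
  then show ?thesis by (simp add: Self_def mtopology_euclidean)
qed

lemma uniformly_continuous:
  fixes f :: "'z \<Rightarrow> real"
  assumes "continuous_on UNIV f" and "e > 0"
  obtains \<delta> where "\<delta> > 0" "\<And>z w. d z w < \<delta> \<Longrightarrow> \<bar>f z - f w\<bar> < e"
proof -
  have "uniformly_continuous_map Self euclidean_metric f"
    using assms(1) compact_UNIV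
    by (intro continuous_imp_uniformly_continuous_map)
      (simp_all add: Self_def mtopology_euclidean compact_space_def)
  then show thesis
    using that assms(2) unfolding uniformly_continuous_map_def
    by (auto simp: dist_real_def)
qed

lemma bounded_continuous:
  fixes f :: "'z \<Rightarrow> real"
  assumes "continuous_on UNIV f"
  obtains B where "\<And>z. \<bar>f z\<bar> \<le> B"
  using compact_imp_bounded[OF compact_continuous_image[OF assms compact_UNIV]]
  by (auto simp: bounded_real)

lemma integrable_continuous:
  fixes f :: "'z \<Rightarrow> real"
  assumes "continuous_on UNIV f" "prob_space M" "sets M = sets borel"
  shows "integrable M f"
proof -
  interpret prob_space M by fact
  obtain B where "\<And>z. \<bar>f z\<bar> \<le> B" using bounded_continuous[OF assms(1)] by blast
  moreover have "f \<in> borel_measurable M"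
    using borel_measurable_continuous_onI[OF assms(1)] measurable_cong_sets[OF assms(3) refl] by blast
  ultimately show ?thesis by (intro integrable_const_bound[of _ B]) auto
qed

lemma finite_net:
  assumes "e > 0"
  obtains xs where "\<And>w. \<exists>i<length xs. d (xs ! i) w < e"
proof -
  have "UNIV \<subseteq> (\<Union>z. mball z e)" using assms by auto
  then obtain F where "finite F" "UNIV \<subseteq> (\<Union>z\<in>F. mball z e)"
    using compactE_image[OF compact_UNIV, of UNIV "\<lambda>z. mball z e"] open_mball by metis
  moreover obtain xs where "set xs = F" using finite_list[OF \<open>finite F\<close>] by blast
  ultimately have "\<exists>i<length xs. d (xs ! i) w < e" for w
    by (auto simp: set_eq_iff in_set_conv_nth subset_eq) (metis in_set_conv_nth)
  then show thesis by (rule that)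
qed

section \<open>Closed sets as zero sets of Lipschitz functions\<close>

definition point_dist :: "'z set \<Rightarrow> 'z \<Rightarrow> real" where
  "point_dist C z = (INF w\<in>C. d z w)"

lemma bdd_below_dist: "bdd_below (d z ` C)"
  by (rule bdd_belowI[of _ 0]) auto

lemma point_dist_nonneg: "C \<noteq> {} \<Longrightarrow> 0 \<le> point_dist C z"
  unfolding point_dist_def by (rule cINF_greatest) auto

lemma point_dist_lipschitz:
  assumes "C \<noteq> {}"
  shows "\<bar>point_dist C z - point_dist C w\<bar> \<le> d z w"
proof -
  have "point_dist C z - d z w \<le> point_dist C w" for z w
    unfolding point_dist_def[of C w]
  proof (rule cINF_greatest[OF assms])
    fix v assume "v \<in> C"
    then have "point_dist C z \<le> d z v"
      unfolding point_dist_def by (rule cINF_lower[OF bdd_below_dist])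
    then show "point_dist C z - d z w \<le> d w v" using triangle[of z w v] by simp
  qed
  from this[of z w] this[of w z] show ?thesis by (simp add: commute abs_le_iff)
qed

lemma point_dist_eq_0_iff:
  assumes "C \<noteq> {}" "closed C"
  shows "point_dist C z = 0 \<longleftrightarrow> z \<in> C"
proof
  assume "z \<in> C"
  then have "point_dist C z \<le> d z z"
    unfolding point_dist_def by (rule cINF_lower[OF bdd_below_dist])
  then show "point_dist C z = 0" using point_dist_nonneg[OF assms(1), of z] by simp
next
  assume 0: "point_dist C z = 0"
  show "z \<in> C"
  proof (rule ccontr)
    assume "z \<notin> C"
    then obtain r where r: "r > 0" "mball z r \<subseteq> - C"
      using assms(2) openin_mtopology[of "- C"] by (auto simp: mtopology_euclidean open_Compl)
    have "r \<le> point_dist C z"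
      unfolding point_dist_def using r by (intro cINF_greatest assms) (force simp: not_less)
    with 0 r show False by simp
  qed
qed

text \<open>
  Points are coded by their indices in finite nets of mesh \<open>2\<^sup>-\<^sup>n\<close>. Along a subsequence
  the laws of all finite code prefixes converge, and Kolmogorov's theorem turns the limits into a
  random code. Almost surely each of its prefixes is the code of some point, so the net points
  it names form a Cauchy sequence; the law of their limit is the weak limit.
\<close>

theorem weakly_convergent_subsequence:
  fixes M :: "nat \<Rightarrow> 'z measure"
  assumes prob: "\<And>j. prob_space (M j)" and sets: "\<And>j. sets (M j) = sets borel"
  obtains r :: "nat \<Rightarrow> nat" and \<pi> :: "'z measure"
  where "strict_mono r" "prob_space \<pi>" "sets \<pi> = sets borel"
    and "\<And>f :: 'z \<Rightarrow> real. continuous_on UNIV f \<Longrightarrow>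
      (\<lambda>j. integral\<^sup>L (M (r j)) f) \<longlonglongrightarrow> integral\<^sup>L \<pi> f"
proof -
  have space: "space (M j) = UNIV" for j
    using sets_eq_imp_space_eq[OF sets] by simp
  have "\<exists>xs. \<forall>w. \<exists>i<length xs. d (xs ! i) w < (1 / 2) ^ n" for n
    by (rule finite_net[of "(1 / 2) ^ n"]) auto
  then obtain xs where xs: "\<And>n w. \<exists>i<length (xs n). d (xs n ! i) w < (1 / 2) ^ n"
    by metis
  \<comment> \<open>Choosing the least admissible index makes \<open>s n\<close> Borel measurable:
    it cuts the space into finitely many differences of balls.\<close>
  define s where "s n w = (LEAST i. i < length (xs n) \<and> d (xs n ! i) w < (1 / 2) ^ n)" for n w
  have s: "s n w < length (xs n)" "d (xs n ! s n w) w < (1 / 2) ^ n" for n w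
    using LeastI_ex[OF xs[of n w]] unfolding s_def by auto
  define code where "code n w = map (\<lambda>i. s i w) [0..<n]" for n w
  have s_meas: "s n \<in> measurable borel (count_space UNIV)" for n
  proof -
    have "{w. i < length (xs n) \<and> d (xs n ! i) w < (1 / 2) ^ n} \<in> sets borel" for i
    proof (cases "i < length (xs n)")
      case True
      have "{w. d (xs n ! i) w < (1 / 2) ^ n} = mball (xs n ! i) ((1 / 2) ^ n)" by auto
      then show ?thesis using True open_mball by auto
    qed simp
    then have "{w \<in> space (borel :: 'z measure). i < length (xs n) \<and> d (xs n ! i) w < (1 / 2) ^ n} \<in> sets borel" for i
      unfolding space_borel by (simp only: UNIV_I simp_thms)
    then show ?thesis
      unfolding s_def pred_def[symmetric] by (intro measurable_Least)
  qed
  have code_meas: "code n \<in> measurable borel (count_space UNIV)" for n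
    unfolding code_def by (intro measurable_map_upt s_meas)
  have code_measM: "code n \<in> measurable (M j) (count_space UNIV)" for n j
    using code_meas measurable_cong_sets[OF sets refl] by blast
  define W where "W n = {ws. set ws \<subseteq> (\<Union>i<n. {..<length (xs i)}) \<and> length ws = n}" for n
  have W_fin: "finite (W n)" for n
    unfolding W_def by (rule finite_lists_length_eq) auto
  have code_W: "code n w \<in> W n" for n w
    using s by (auto simp: W_def code_def)
  define p where "p j ws = measure (M j) {w. code (length ws) w = ws}" for j ws
  \<comment> \<open>A countable product of unit intervals is compact and metrizable, so one
    subsequence makes the probabilities of all words converge at once. This stands in for a diagonal
    argument.\<close>
  have cube: "seq_compact {\<phi> :: nat list \<Rightarrow> real. \<forall>ws. \<phi> ws \<in> {0..1}}"
    using compactin_PiE[of "\<lambda>_. euclidean :: real topology" "UNIV :: nat list set" "\<lambda>_. {0..1}"]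
    unfolding euclidean_product_topology
    by (simp add: PiE_def Pi_def flip: compact_eq_seq_compact_metric)
  have p_cube: "\<forall>j. p j \<in> {\<phi>. \<forall>ws. \<phi> ws \<in> {0..1}}"
    using prob_space.prob_le_1[OF prob] by (auto simp: p_def)
  obtain q r where r: "strict_mono r" "(p \<circ> r) \<longlonglongrightarrow> q"
    by (rule seq_compactE[OF cube p_cube])
  have q: "(\<lambda>j. p (r j) ws) \<longlonglongrightarrow> q ws" for ws
    using continuous_on_tendsto_compose[OF continuous_on_product_coordinates r(2), of ws]
    by (simp add: comp_def)
  have p_sum: "(\<integral>w. F (code n w) \<partial>M j) = (\<Sum>ws\<in>W n. F ws * p j ws)"
    for F :: "nat list \<Rightarrow> real" and n j
  proof -
    interpret prob_space "M j" by (rule prob)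
    have ev: "{w. code n w = ws} \<in> sets (M j)" for ws
      using measurable_sets[OF code_meas, of "{ws}" n] by (simp add: vimage_def sets)
    have "(\<integral>w. F (code n w) \<partial>M j) =
        (\<integral>w. (\<Sum>ws\<in>W n. F ws * indicator {w. code n w = ws} w) \<partial>M j)"
    proof (rule Bochner_Integration.integral_cong[OF refl])
      fix w
      have "(\<Sum>ws\<in>W n. F ws * indicator {w. code n w = ws} w) =
          (\<Sum>ws\<in>W n. if ws = code n w then F ws else 0)"
        by (rule sum.cong) auto
      then show "F (code n w) = (\<Sum>ws\<in>W n. F ws * indicator {w. code n w = ws} w)"
        using code_W W_fin by simp
    qed
    also have "\<dots> = (\<Sum>ws\<in>W n. F ws * measure (M j) {w. code n w = ws})"
      using ev by (subst Bochner_Integration.integral_sum)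
        (auto intro!: integrable_mult_right integrable_real_indicator simp: less_top[symmetric] space)
    also have "\<dots> = (\<Sum>ws\<in>W n. F ws * p j ws)"
      by (rule sum.cong) (auto simp: p_def W_def)
    finally show ?thesis .
  qed
  have sum_lim: "(\<lambda>j. \<integral>w. F (code n w) \<partial>M (r j)) \<longlonglongrightarrow> (\<Sum>ws\<in>W n. F ws * q ws)" for F n
    unfolding p_sum by (intro tendsto_intros q)
  have q_nonneg: "0 \<le> q ws" for ws
    by (rule LIMSEQ_le_const[OF q]) (auto simp: p_def)
  \<comment> \<open>No mass escapes in the limit, because there are only finitely many words of each
    length; this is where the nets have to be finite.\<close>
  have q_sum: "(\<Sum>ws\<in>W n. q ws) = 1" for n
    using LIMSEQ_unique[OF sum_lim[of "\<lambda>_. 1" n]] prob_space.prob_space[OF prob]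
    by (simp add: space)
  define R where "R n = embed_pmf (\<lambda>ws. if ws \<in> W n then q ws else 0)" for n
  have R: "pmf (R n) ws = (if ws \<in> W n then q ws else 0)" for n ws
    unfolding R_def
  proof (rule pmf_embed_pmf)
    have "(\<integral>\<^sup>+ ws. ennreal (if ws \<in> W n then q ws else 0) \<partial>count_space UNIV) =
        (\<Sum>ws\<in>W n. ennreal (if ws \<in> W n then q ws else 0))"
      by (rule nn_integral_count_space') (auto simp: W_fin)
    also have "\<dots> = 1" using q_sum[of n] q_nonneg by (simp add: sum_ennreal)
    finally show "(\<integral>\<^sup>+ ws. ennreal (if ws \<in> W n then q ws else 0) \<partial>count_space UNIV) = 1" .
  qed (use q_nonneg in auto)
  have R_set: "set_pmf (R n) \<subseteq> W n" for n
    by (auto simp: set_pmf_eq R)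
  have R_lim: "(\<lambda>j. \<integral>w. F (code n w) \<partial>M (r j)) \<longlonglongrightarrow> (\<integral>ws. F ws \<partial>measure_pmf (R n))"
    for F :: "nat list \<Rightarrow> real" and n
  proof -
    have "(\<integral>ws. F ws \<partial>measure_pmf (R n)) = (\<Sum>ws\<in>W n. F ws * pmf (R n) ws)"
      using R_set W_fin by (intro integral_measure_pmf_real) auto
    then show ?thesis using sum_lim[of F n] by (simp add: R)
  qed
  have R_cons: "map_pmf (take n) (R (Suc n)) = R n" for n
  proof (rule pmf_eqI)
    fix u
    have "(\<lambda>j. \<integral>w. indicator {u} (take n (code (Suc n) w)) \<partial>M (r j)) \<longlonglongrightarrow>
        (\<integral>ws. indicator {u} (take n ws) \<partial>measure_pmf (R (Suc n)) :: real)"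
      by (rule R_lim[of "\<lambda>ws. indicator {u} (take n ws)"])
    moreover have "take n (code (Suc n) w) = code n w" for w by (simp add: code_def)
    ultimately have "(\<integral>ws. indicator {u} (take n ws) \<partial>measure_pmf (R (Suc n))) =
        (\<integral>ws. indicator {u} ws \<partial>measure_pmf (R n) :: real)"
      using LIMSEQ_unique R_lim[of "indicator {u}" n] by auto
    moreover have "indicator {u} (take n ws) = (indicator (take n -` {u}) ws :: real)" for ws
      by (simp add: indicator_def)
    ultimately show "pmf (map_pmf (take n) (R (Suc n))) u = pmf (R n) u"
      by (simp add: pmf.rep_eq)
  qed
  \<comment> \<open>A word that codes no point has probability 0 under every \<open>M j\<close>,
    hence in the limit. A limiting prefix is thus always realized by an actual point, which is what
    keeps its net points close together.\<close>
  have R_code: "ws \<in> range (code n)" if "ws \<in> set_pmf (R n)" for n ws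
  proof (rule ccontr)
    assume "ws \<notin> range (code n)"
    then have "indicator {ws} (code n w) = (0 :: real)" for w by (auto simp: indicator_def)
    then have "(\<integral>ws'. indicator {ws} ws' \<partial>measure_pmf (R n)) = (0 :: real)"
      using LIMSEQ_unique[OF R_lim[of "indicator {ws}" n]] by simp
    with that show False by (simp add: set_pmf_eq pmf.rep_eq)
  qed
  have "length ws = n" if "ws \<in> set_pmf (R n)" for n ws
    using R_set that by (auto simp: W_def)
  then obtain \<nu> :: "(nat \<Rightarrow> nat) measure" where "prob_space \<nu>"
    and coord: "\<And>i. (\<lambda>a. a i) \<in> measurable \<nu> (count_space UNIV)"
    and distr_\<nu>: "\<And>n. distr \<nu> (count_space UNIV) (\<lambda>a. map a [0..<n]) = measure_pmf (R n)"
    using word_pmfs_extension[of R] R_cons by blast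
  interpret \<nu>: prob_space \<nu> by fact
  have word[measurable]: "(\<lambda>a. map a [0..<n]) \<in> measurable \<nu> (count_space UNIV)" for n
    by (intro measurable_map_upt coord)
  define G where "G = {a \<in> space \<nu>. \<forall>n. map a [0..<n] \<in> range (code n)}"
  have G_meas: "G \<in> sets \<nu>"
    unfolding G_def by measurable
  have "AE a in \<nu>. map a [0..<n] \<in> range (code n)" for n
  proof -
    have "AE ws in distr \<nu> (count_space UNIV) (\<lambda>a. map a [0..<n]). ws \<in> range (code n)"
      unfolding distr_\<nu> using R_code by (auto intro: AE_pmfI)
    then show ?thesis by (subst (asm) AE_distr_iff) (auto simp: word)
  qed
  then have AE_G: "AE a in \<nu>. a \<in> G"
    unfolding G_def by (simp add: AE_all_countable AE_conjI)
  have G_approx: "\<exists>\<zeta>. \<forall>n. d (xs n ! a n) \<zeta> \<le> 2 * (1 / 2) ^ n" if "a \<in> G" for a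
  proof -
    \<comment> \<open>The prefix of length \<open>Suc m\<close> is the code of one point
      \<open>w\<close>, and both net points are near this \<open>w\<close>, at distance less than
      2^-n and 2^-m respectively.\<close>
    have near: "d (xs n ! a n) (xs m ! a m) < 2 * (1 / 2) ^ n" if "n \<le> m" for n m
    proof -
      obtain w where w: "map a [0..<Suc m] = code (Suc m) w"
        using \<open>a \<in> G\<close> unfolding G_def by blast
      have "a i = s i w" if "i \<le> m" for i
        using arg_cong[OF w, of "\<lambda>ws. ws ! i"] that
        by (simp add: code_def nth_append split: if_splits)
      then have "d (xs n ! a n) w < (1 / 2) ^ n" "d (xs m ! a m) w < (1 / 2) ^ m"
        using s \<open>n \<le> m\<close> by auto
      moreover have "(1 / 2 :: real) ^ m \<le> (1 / 2) ^ n"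
        using \<open>n \<le> m\<close> by (intro power_decreasing) auto
      ultimately show ?thesis
        using triangle[OF UNIV_I UNIV_I UNIV_I, of "xs n ! a n" "xs m ! a m" w] commute[of w "xs m ! a m"] by linarith
    qed
    have "MCauchy (\<lambda>n. xs n ! a n)"
      unfolding MCauchy_def
    proof (intro conjI allI impI)
      fix e :: real assume "e > 0"
      then obtain N where N: "(1 / 2) ^ N < e / 2"
        using real_arch_pow_inv[of "e / 2" "1 / 2"] by auto
      have "d (xs n ! a n) (xs m ! a m) < e" if "N \<le> n" "n \<le> m" for n m
      proof -
        have "(1 / 2 :: real) ^ n \<le> (1 / 2) ^ N" using that by (intro power_decreasing) auto
        then show ?thesis using near[OF that(2)] N by linarith
      qed
      then show "\<exists>N. \<forall>n n'. N \<le> n \<longrightarrow> N \<le> n' \<longrightarrow> d (xs n ! a n) (xs n' ! a n') < e"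
        by (metis commute nle_le)
    qed simp
    moreover have mcomplete
      using compact_UNIV
      by (intro compact_space_imp_mcomplete) (simp add: mtopology_euclidean compact_space_def)
    ultimately obtain \<zeta> where "limitin mtopology (\<lambda>n. xs n ! a n) \<zeta> sequentially"
      unfolding mcomplete_def by blast
    then have lim: "\<exists>N. \<forall>n\<ge>N. d (xs n ! a n) \<zeta> < e" if "e > 0" for e
      using that unfolding limit_metric_sequentially by auto
    have "d (xs n ! a n) \<zeta> \<le> 2 * (1 / 2) ^ n" for n
    proof (rule field_le_epsilon)
      fix e :: real assume "e > 0"
      then obtain N where N: "\<And>m. m \<ge> N \<Longrightarrow> d (xs m ! a m) \<zeta> < e" using lim by blast
      define m where "m = max n N"
      have m: "n \<le> m" "N \<le> m" by (auto simp: m_def)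
      show "d (xs n ! a n) \<zeta> \<le> 2 * (1 / 2) ^ n + e"
        using near[OF m(1)] N[OF m(2)]
          triangle[OF UNIV_I UNIV_I UNIV_I, of "xs n ! a n" \<zeta> "xs m ! a m"]
        by linarith
    qed
    then show ?thesis by blast
  qed
  define g where "g a = (if a \<in> G then SOME \<zeta>. \<forall>n. d (xs n ! a n) \<zeta> \<le> 2 * (1 / 2) ^ n else undefined)" for a
  have g: "d (xs n ! a n) (g a) \<le> 2 * (1 / 2) ^ n" if "a \<in> G" for a n
    using someI_ex[OF G_approx[OF that]] that by (simp add: g_def)
  have g_meas: "g \<in> measurable \<nu> borel"
  proof (rule borel_measurableI)
    fix S :: "'z set" assume "open S"
    show "g -` S \<inter> space \<nu> \<in> sets \<nu>"
    proof (cases "S = UNIV")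
      case False
      then have ne: "- S \<noteq> {}" by auto
      \<comment> \<open>Off \<open>G\<close> the value is the one taken at the default point of
        \<open>g\<close>, so \<open>u n\<close> converges at every \<open>a\<close> and not just
        almost everywhere. Then \<open>S\<close> is pulled back by \<open>g\<close> to the set where
        the limit is nonzero.\<close>
      define u where "u n a = (if a \<in> G then point_dist (- S) (xs n ! a n)
        else point_dist (- S) undefined)" for n a
      have "(\<lambda>a. point_dist (- S) (g a)) \<in> borel_measurable \<nu>"
      proof (rule borel_measurable_LIMSEQ_real)
        show "u n \<in> borel_measurable \<nu>" for n
        proof -
          have "(\<lambda>a. point_dist (- S) (xs n ! a n)) \<in> borel_measurable \<nu>"
            by (rule measurable_compose[OF coord]) simp
          then show ?thesis unfolding u_def using G_meas by (intro measurable_If_set) auto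
        qed
        show "(\<lambda>n. u n a) \<longlonglongrightarrow> point_dist (- S) (g a)" for a
        proof (cases "a \<in> G")
          case True
          have "(\<lambda>n. point_dist (- S) (xs n ! a n)) \<longlonglongrightarrow> point_dist (- S) (g a)"
          proof (rule LIM_zero_cancel, rule Lim_null_comparison)
            show "\<forall>\<^sub>F n in sequentially. norm (point_dist (- S) (xs n ! a n) - point_dist (- S) (g a))
                \<le> 2 * (1 / 2) ^ n"
              unfolding real_norm_def
              by (intro always_eventually allI order_trans[OF point_dist_lipschitz[OF ne] g[OF True]])
            show "(\<lambda>n. 2 * (1 / 2) ^ n :: real) \<longlonglongrightarrow> 0"
              by (intro tendsto_mult_right_zero LIMSEQ_power_zero) auto
          qed
          then show ?thesis using True by (simp add: u_def)
        qed (simp add: u_def g_def)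
      qed
      then have "(\<lambda>a. point_dist (- S) (g a)) -` (- {0}) \<inter> space \<nu> \<in> sets \<nu>"
        by (rule measurable_sets) auto
      moreover have "(\<lambda>a. point_dist (- S) (g a)) -` (- {0}) = g -` S"
        using point_dist_eq_0_iff[OF ne] \<open>open S\<close> by auto
      ultimately show ?thesis by simp
    qed simp
  qed
  show thesis
  proof
    show "strict_mono r" by fact
    show "prob_space (distr \<nu> borel g)" by (rule \<nu>.prob_space_distr[OF g_meas])
    show "sets (distr \<nu> borel g) = sets borel" by simp
    fix f :: "'z \<Rightarrow> real" assume f: "continuous_on UNIV f"
    have f_meas: "f \<in> borel_measurable borel" by (rule borel_measurable_continuous_onI[OF f])
    obtain B where B: "\<And>z. \<bar>f z\<bar> \<le> B" using bounded_continuous[OF f] by blast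
    have int_g: "integral\<^sup>L (distr \<nu> borel g) f = (\<integral>a. f (g a) \<partial>\<nu>)"
      by (rule integral_distr[OF g_meas f_meas])
    show "(\<lambda>j. integral\<^sup>L (M (r j)) f) \<longlonglongrightarrow> integral\<^sup>L (distr \<nu> borel g) f"
    proof (rule LIMSEQ_I)
      fix e :: real assume "e > 0"
      then obtain \<delta> where \<delta>: "\<delta> > 0" "\<And>z w. d z w < \<delta> \<Longrightarrow> \<bar>f z - f w\<bar> < e / 4"
        using uniformly_continuous[OF f, of "e / 4"] by auto
      \<comment> \<open>The net point at level \<open>n\<close> is within 2^-n of a point it codes,
        but only within 2 * 2^-n of the limit point \<open>g a\<close>; the bound covers
        both.\<close>
      obtain n where n: "(1 / 2) ^ n < \<delta> / 2"
        using real_arch_pow_inv[of "\<delta> / 2" "1 / 2"] \<delta> by auto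
      \<comment> \<open>\<open>F\<close> evaluates \<open>f\<close> at the net point named by letter
        \<open>n\<close>, the last letter of a prefix of length \<open>Suc n\<close>. Replacing
        \<open>f\<close> by \<open>F\<close> costs at most e/4 under each \<open>M j\<close> and e/4
        under the limit, and the convergence of prefix laws supplies the remaining e/4.\<close>
      define F where "F ws = f (xs n ! (ws ! n))" for ws
      have approx_M: "\<bar>integral\<^sup>L (M j) f - (\<integral>w. F (code (Suc n) w) \<partial>M j)\<bar> \<le> e / 4" for j
      proof -
        interpret prob_space "M j" by (rule prob)
        have "\<bar>f w - F (code (Suc n) w)\<bar> \<le> e / 4" for w
        proof -
          have "d (xs n ! s n w) w < \<delta>" using s(2)[of n w] n \<delta>(1) by linarith
          from \<delta>(2)[OF this] show ?thesis
            by (simp add: F_def code_def nth_append abs_minus_commute)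
        qed
        moreover have "integrable (M j) (\<lambda>w. F (code (Suc n) w))"
          using measurable_compose[OF code_measM, of F] B
          by (intro integrable_const_bound[of _ B]) (auto simp: F_def)
        ultimately show ?thesis
          by (intro abs_integral_diff_le integrable_continuous[OF f prob sets]) auto
      qed
      have approx_\<nu>: "\<bar>(\<integral>a. F (map a [0..<Suc n]) \<partial>\<nu>) - (\<integral>a. f (g a) \<partial>\<nu>)\<bar> \<le> e / 4"
      proof (rule \<nu>.abs_integral_diff_le)
        show "integrable \<nu> (\<lambda>a. F (map a [0..<Suc n]))"
        proof (rule \<nu>.integrable_const_bound)
          show "(\<lambda>a. F (map a [0..<Suc n])) \<in> borel_measurable \<nu>"
            by (rule measurable_compose[OF word]) simp
          show "AE a in \<nu>. norm (F (map a [0..<Suc n])) \<le> B"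
            unfolding F_def using B by simp
        qed
        show "integrable \<nu> (\<lambda>a. f (g a))"
          using measurable_compose[OF g_meas f_meas] B
          by (intro \<nu>.integrable_const_bound[of _ B]) auto
        show "AE a in \<nu>. \<bar>F (map a [0..<Suc n]) - f (g a)\<bar> \<le> e / 4"
          using AE_G
        proof eventually_elim
          case (elim a)
          have "d (xs n ! a n) (g a) < \<delta>" using g[OF elim, of n] n by linarith
          from \<delta>(2)[OF this] show ?case by (simp add: F_def nth_append)
        qed
      qed
      have "(\<integral>ws. F ws \<partial>measure_pmf (R (Suc n))) = (\<integral>a. F (map a [0..<Suc n]) \<partial>\<nu>)"
        unfolding distr_\<nu>[symmetric] by (rule integral_distr) (auto simp: word simp del: upt_Suc)
      then have "(\<lambda>j. \<integral>w. F (code (Suc n) w) \<partial>M (r j)) \<longlonglongrightarrow> (\<integral>a. F (map a [0..<Suc n]) \<partial>\<nu>)"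
        using R_lim[of F "Suc n"] by simp
      then obtain N where N: "\<And>j. j \<ge> N \<Longrightarrow>
          \<bar>(\<integral>w. F (code (Suc n) w) \<partial>M (r j)) - (\<integral>a. F (map a [0..<Suc n]) \<partial>\<nu>)\<bar> < e / 4"
        using LIMSEQ_D[of _ _ "e / 4"] \<open>e > 0\<close> by (metis real_norm_def zero_less_divide_iff zero_less_numeral)
      have "norm (integral\<^sup>L (M (r j)) f - integral\<^sup>L (distr \<nu> borel g) f) < e" if "j \<ge> N" for j
        using N[OF that] approx_M[of "r j"] approx_\<nu> \<open>e > 0\<close> unfolding int_g real_norm_def by linarith
      then show "\<exists>N. \<forall>j\<ge>N. norm (integral\<^sup>L (M (r j)) f - integral\<^sup>L (distr \<nu> borel g) f) < e"
        by blast
    qed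
  qed
qed

section \<open>A countable determining family of Lipschitz functions\<close>

text \<open>A Lipschitz approximation from above of the indicator of a closed set, sharpening as
  \<open>m\<close> grows. The empty set is split off because \<open>point_dist\<close> is then an
  infimum over nothing; the value 0 is the correct indicator.\<close>

definition bump :: "'z set \<Rightarrow> nat \<Rightarrow> 'z \<Rightarrow> real" where
  "bump C m z = (if C = {} then 0 else max 0 (1 - real m * point_dist C z))"

lemma bump_nonneg: "0 \<le> bump C m z"
  by (simp add: bump_def)

lemma bump_le_1: "bump C m z \<le> 1"
  by (simp add: bump_def point_dist_nonneg)

lemma bump_lipschitz: "\<bar>bump C m z - bump C m w\<bar> \<le> real m * d z w"
proof (cases "C = {}")
  case False
  have "\<bar>bump C m z - bump C m w\<bar> \<le> \<bar>real m * point_dist C z - real m * point_dist C w\<bar>"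
    using False by (simp add: bump_def)
  also have "\<dots> = real m * \<bar>point_dist C z - point_dist C w\<bar>"
    by (simp add: abs_mult flip: right_diff_distrib)
  also have "\<dots> \<le> real m * d z w"
    by (intro mult_left_mono point_dist_lipschitz False) simp
  finally show ?thesis .
qed (simp add: bump_def)

lemma bump_tendsto_indicator:
  assumes "closed C"
  shows "(\<lambda>m. bump C m z) \<longlonglongrightarrow> indicator C z"
proof (cases "C = {} \<or> z \<in> C")
  case True
  then have "bump C m z = indicator C z" for m
    using point_dist_eq_0_iff[OF _ assms, of z] by (cases "C = {}") (auto simp: bump_def)
  then show ?thesis by simp
next
  case False
  then have "point_dist C z > 0"
    using point_dist_eq_0_iff[OF _ assms, of z] point_dist_nonneg[of C z] by auto
  then obtain N where N: "1 < real N * point_dist C z"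
    using reals_Archimedean3 by blast
  have "bump C m z = 0" if "m \<ge> N" for m
  proof -
    have "real N * point_dist C z \<le> real m * point_dist C z"
      using that \<open>point_dist C z > 0\<close> by (intro mult_right_mono) auto
    with N show ?thesis by (simp add: bump_def)
  qed
  then have "\<forall>\<^sub>F m in sequentially. bump C m z = indicator C z"
    using False by (auto simp: eventually_sequentially)
  then show ?thesis by (rule tendsto_eventually)
qed

lemma integral_bump_tendsto_measure:
  assumes "closed C" "prob_space M" "sets M = sets borel"
  shows "(\<lambda>m. integral\<^sup>L M (bump C m)) \<longlonglongrightarrow> measure M C"
proof -
  interpret prob_space M by fact
  have C: "C \<in> sets M" using assms by simp
  have "(\<lambda>m. integral\<^sup>L M (bump C m)) \<longlonglongrightarrow> integral\<^sup>L M (indicator C)"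
  proof (rule integral_dominated_convergence[where w = "\<lambda>_. 1"])
    show "bump C m \<in> borel_measurable M" for m
      using integrable_continuous[OF lipschitz_continuous[OF bump_lipschitz] assms(2,3)] by blast
    show "AE z in M. (\<lambda>m. bump C m z) \<longlonglongrightarrow> indicator C z"
      using bump_tendsto_indicator[OF assms(1)] by simp
    show "AE z in M. norm (bump C m z) \<le> 1" for m
      using bump_nonneg bump_le_1 by simp
  qed (use C in auto)
  then show ?thesis using C by simp
qed

text \<open>Finite intersections of complements of net balls form a countable family of closed sets
  that is stable under intersection and generates the Borel sets, so a probability measure is
  determined by its values on it. Each such value is a limit of integrals of bumps. The range [0,1]
  and the Lipschitz bound make the bumps usable as perturbations of a cost.\<close>

theorem countable_determining_family:
  obtains e :: "nat \<Rightarrow> 'z \<Rightarrow> real"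
  where "\<And>k z. 0 \<le> e k z" "\<And>k z. e k z \<le> 1"
    and "\<And>k. \<exists>L\<ge>0. \<forall>z w. \<bar>e k z - e k w\<bar> \<le> L * d z w"
    and "\<And>M N. \<lbrakk>prob_space M; sets M = sets borel; prob_space N; sets N = sets borel;
      \<And>k. integral\<^sup>L M (e k) = integral\<^sup>L N (e k)\<rbrakk> \<Longrightarrow> M = N"
proof -
  have "\<exists>xs. \<forall>w. \<exists>i<length xs. d (xs ! i) w < (1 / 2) ^ n" for n
    by (rule finite_net[of "(1 / 2) ^ n"]) auto
  then obtain xs where xs: "\<And>n w. \<exists>i<length (xs n). d (xs n ! i) w < (1 / 2) ^ n"
    by metis
  define B where "B = (\<lambda>(n, i). mball (xs n ! i) ((1 / 2) ^ n))"
  \<comment> \<open>Indexing by lists keeps the family countable, turns intersection into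
    concatenation, and yields the whole space at the empty list.\<close>
  define E where "E L = - (\<Union>p\<in>set L. B p)" for L
  have B_open: "open (B p)" for p
    unfolding B_def by (cases p) (simp add: open_mball)
  have E_closed: "closed (E L)" for L
    unfolding E_def by (intro closed_Compl open_UN) (simp add: B_open)
  have open_UN_B: "U = \<Union> (B ` {p. B p \<subseteq> U})" if "open U" for U
  proof (intro equalityI subsetI)
    fix w assume "w \<in> U"
    then obtain r where r: "r > 0" "mball w r \<subseteq> U"
      using \<open>open U\<close> openin_mtopology[of U] by (auto simp: mtopology_euclidean)
    obtain n where n: "(1 / 2) ^ n < r / 2"
      using real_arch_pow_inv[of "r / 2" "1 / 2"] r by auto
    obtain i where i: "d (xs n ! i) w < (1 / 2) ^ n" using xs by blast
    have "B (n, i) \<subseteq> mball w r"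
    proof
      fix v assume "v \<in> B (n, i)"
      then have "d (xs n ! i) v < (1 / 2) ^ n" by (simp add: B_def)
      then have "d w v < r"
        using i n triangle[OF UNIV_I UNIV_I UNIV_I, of w v "xs n ! i"] commute[of w "xs n ! i"]
        by linarith
      then show "v \<in> mball w r" by simp
    qed
    then show "w \<in> \<Union> (B ` {p. B p \<subseteq> U})" using r i by (force simp: B_def)
  qed auto
  have borel_E: "sets borel = sigma_sets UNIV (range E)"
  proof
    have "U \<in> sigma_sets UNIV (range E)" if "open U" for U
    proof -
      have "B p \<in> sigma_sets UNIV (range E)" for p
      proof -
        have "UNIV - E [p] \<in> sigma_sets UNIV (range E)"
          by (intro sigma_sets.Compl sigma_sets.Basic) simp
        then show ?thesis by (simp add: E_def Compl_eq_Diff_UNIV Diff_Diff_Int)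
      qed
      then have "\<Union> (B ` {p. B p \<subseteq> U}) \<in> sigma_sets UNIV (range E)"
        by (intro sigma_sets_UNION) auto
      then show ?thesis using open_UN_B[OF that] by simp
    qed
    then show "sets borel \<subseteq> sigma_sets UNIV (range E)"
      unfolding borel_def by (auto intro!: sigma_sets_mono simp: sets_measure_of)
    show "sigma_sets UNIV (range E) \<subseteq> sets borel"
      using borel_closed[OF E_closed] sets.sigma_sets_subset[of "range E" borel] by auto
  qed
  define e where "e k = (case from_nat k of (L, m) \<Rightarrow> bump (E L) m)" for k
  show thesis
  proof
    show "0 \<le> e k z" "e k z \<le> 1" for k z
      by (simp_all add: e_def bump_nonneg bump_le_1 split: prod.split)
    show "\<exists>L\<ge>0. \<forall>z w. \<bar>e k z - e k w\<bar> \<le> L * d z w" for k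
    proof -
      obtain L m where "e k = bump (E L) m" unfolding e_def by (cases "from_nat k :: (nat \<times> nat) list \<times> nat") auto
      then show ?thesis using bump_lipschitz by (intro exI[of _ "real m"]) simp
    qed
    fix M N :: "'z measure"
    assume M: "prob_space M" "sets M = sets borel" and N: "prob_space N" "sets N = sets borel"
      and eq: "\<And>k. integral\<^sup>L M (e k) = integral\<^sup>L N (e k)"
    have same: "integral\<^sup>L M (bump (E L) m) = integral\<^sup>L N (bump (E L) m)" for L m
      using eq[of "to_nat (L, m)"] by (simp add: e_def)
    have "measure M (E L) = measure N (E L)" for L
      using LIMSEQ_unique[OF integral_bump_tendsto_measure[OF E_closed M, of L]]
        integral_bump_tendsto_measure[OF E_closed N, of L] by (simp add: same)
    moreover have "emeasure M X = measure M X" "emeasure N X = measure N X" for X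
      using M(1) N(1) by (auto simp: prob_space_def finite_measure.emeasure_eq_measure)
    ultimately have "emeasure M X = emeasure N X" if "X \<in> range E" for X
      using that by auto
    moreover have "Int_stable (range E)"
    proof (rule Int_stableI_image)
      fix L L'
      have "E L \<inter> E L' = E (L @ L')" by (auto simp: E_def)
      then show "\<exists>L''\<in>UNIV. E L \<inter> E L' = E L''" by blast
    qed
    moreover have "emeasure M (E []) \<noteq> \<infinity>"
      using M(1) by (simp add: prob_space_def finite_measure.emeasure_finite)
    moreover have E_Nil: "E [] = UNIV" by (simp add: E_def)
    moreover have "UNIV \<in> range E" using E_Nil by (metis rangeI)
    ultimately show "M = N"
      using M(2) N(2) borel_E
      by (intro measure_eqI_generator_eq[where E = "range E" and \<Omega> = UNIV and A = "\<lambda>_. E []"]) auto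
  qed
qed

section \<open>Generic uniqueness of minimizers\<close>

text \<open>The direct method: a minimizing sequence has a weak limit point, which lies in
  \<open>K\<close> by closedness, and the integral of the continuous cost passes to the
  limit.\<close>

lemma weak_limit_minimizer:
  fixes K :: "'z measure set" and c :: "'z \<Rightarrow> real"
  assumes prob: "\<And>\<pi>. \<pi> \<in> K \<Longrightarrow> prob_space \<pi> \<and> sets \<pi> = sets borel"
    and ne: "K \<noteq> {}"
    and weakly_closed: "\<And>\<rho> \<pi>. \<lbrakk>\<And>j :: nat. \<rho> j \<in> K; prob_space \<pi>; sets \<pi> = sets borel;
      \<And>f :: 'z \<Rightarrow> real. continuous_on UNIV f \<Longrightarrow>
        (\<lambda>j. integral\<^sup>L (\<rho> j) f) \<longlonglongrightarrow> integral\<^sup>L \<pi> f\<rbrakk> \<Longrightarrow> \<pi> \<in> K"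
    and c: "continuous_on UNIV c"
  obtains \<pi> where "\<pi> \<in> K" "\<And>\<pi>'. \<pi>' \<in> K \<Longrightarrow> integral\<^sup>L \<pi> c \<le> integral\<^sup>L \<pi>' c"
proof -
  obtain B where B: "\<And>z. \<bar>c z\<bar> \<le> B" using bounded_continuous[OF c] by blast
  have bdd: "bdd_below ((\<lambda>\<pi>. integral\<^sup>L \<pi> c) ` K)"
  proof (rule bdd_belowI2)
    fix \<pi> assume \<pi>: "\<pi> \<in> K"
    then interpret prob_space \<pi> using prob by blast
    have "- B \<le> c z" for z using B[of z] by linarith
    then show "- B \<le> integral\<^sup>L \<pi> c"
      using prob[OF \<pi>] by (intro integral_ge_const integrable_continuous c) auto
  qed
  define b where "b = (INF \<pi>\<in>K. integral\<^sup>L \<pi> c)"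
  have lower: "b \<le> integral\<^sup>L \<pi> c" if "\<pi> \<in> K" for \<pi>
    unfolding b_def by (rule cINF_lower[OF bdd that])
  have "\<exists>\<pi>\<in>K. integral\<^sup>L \<pi> c < b + 1 / real (Suc j)" for j
    using cINF_less_iff[OF ne bdd, of "b + 1 / real (Suc j)"] by (simp add: b_def)
  then obtain \<rho> where \<rho>: "\<And>j. \<rho> j \<in> K" "\<And>j. integral\<^sup>L (\<rho> j) c < b + 1 / real (Suc j)"
    by metis
  obtain r \<pi> where r: "strict_mono r" and \<pi>: "prob_space \<pi>" "sets \<pi> = sets borel"
    and lim: "\<And>f :: 'z \<Rightarrow> real. continuous_on UNIV f \<Longrightarrow>
      (\<lambda>j. integral\<^sup>L (\<rho> (r j)) f) \<longlonglongrightarrow> integral\<^sup>L \<pi> f"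
    using weakly_convergent_subsequence[of \<rho>] prob \<rho>(1) by metis
  have "\<pi> \<in> K" using weakly_closed[of "\<lambda>j. \<rho> (r j)"] \<rho>(1) \<pi> lim by blast
  moreover have "integral\<^sup>L \<pi> c \<le> b"
  proof (rule LIMSEQ_le[OF lim[OF c]])
    have "(\<lambda>j. b + 1 / real (Suc j)) \<longlonglongrightarrow> b + 0"
      by (intro tendsto_add tendsto_const LIMSEQ_Suc[OF lim_1_over_n])
    then show "(\<lambda>j. b + 1 / real (Suc (r j))) \<longlonglongrightarrow> b"
      using LIMSEQ_subseq_LIMSEQ[OF _ r] by (fastforce simp: comp_def)
  qed (use \<rho>(2) less_imp_le in blast)
  ultimately show thesis using that lower order_trans by blast
qed

text \<open>
  Fix a determining family \<open>e\<close>. A cost has a unique minimizer once, for all \<open>n\<close> and \<open>k\<close>, some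
  nonempty sublevel set of its integral has \<open>e n\<close>-diameter less than \<open>1 / (k + 1)\<close>. This is an open
  condition. It is dense since along \<open>c + t * e n\<close> the near-minimizers at increasing \<open>t\<close> have
  essentially decreasing \<open>e n\<close>-integrals in \<open>[0, 1]\<close>, so that few values of \<open>t\<close> violate it.
\<close>

theorem generic_unique_minimizer:
  fixes K :: "'z measure set" and S :: "'f set" and D :: "'f \<Rightarrow> 'f \<Rightarrow> real"
    and ap :: "'f \<Rightarrow> 'z \<Rightarrow> real"
  assumes prob: "\<And>\<pi>. \<pi> \<in> K \<Longrightarrow> prob_space \<pi> \<and> sets \<pi> = sets borel"
    and ne: "K \<noteq> {}"
    and weakly_closed: "\<And>\<rho> \<pi>. \<lbrakk>\<And>j :: nat. \<rho> j \<in> K; prob_space \<pi>; sets \<pi> = sets borel;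
      \<And>f :: 'z \<Rightarrow> real. continuous_on UNIV f \<Longrightarrow>
        (\<lambda>j. integral\<^sup>L (\<rho> j) f) \<longlonglongrightarrow> integral\<^sup>L \<pi> f\<rbrakk> \<Longrightarrow> \<pi> \<in> K"
    and metric: "Metric_space S D"
    and cont: "\<And>c. c \<in> S \<Longrightarrow> continuous_on UNIV (ap c)"
    and dist: "\<And>c c' z. \<lbrakk>c \<in> S; c' \<in> S\<rbrakk> \<Longrightarrow> \<bar>ap c z - ap c' z\<bar> \<le> D c c'"
    and perturb: "\<And>c g L \<epsilon>. \<lbrakk>c \<in> S; \<And>z. 0 \<le> g z; \<And>z. g z \<le> 1; 0 \<le> L;
        \<And>z w. \<bar>g z - g w\<bar> \<le> L * d z w; \<epsilon> > 0\<rbrakk> \<Longrightarrow>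
      \<exists>T>0. \<forall>t\<in>{0..T}. \<exists>c'\<in>S. D c c' < \<epsilon> \<and> ap c' = (\<lambda>z. ap c z + t * g z)"
  shows "generic_in (Metric_space.mtopology S D)
    {c \<in> S. \<exists>!\<pi>. \<pi> \<in> K \<and> integral\<^sup>L \<pi> (ap c) = (INF \<pi>'\<in>K. integral\<^sup>L \<pi>' (ap c))}"
proof -
  interpret S: Metric_space S D by (rule metric)
  obtain e :: "nat \<Rightarrow> 'z \<Rightarrow> real" where e: "\<And>n z. 0 \<le> e n z" "\<And>n z. e n z \<le> 1"
    and e_lip: "\<And>n. \<exists>L\<ge>0. \<forall>z w. \<bar>e n z - e n w\<bar> \<le> L * d z w"
    and determining: "\<And>M N. \<lbrakk>prob_space M; sets M = sets borel; prob_space N; sets N = sets borel;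
      \<And>n. integral\<^sup>L M (e n) = integral\<^sup>L N (e n)\<rbrakk> \<Longrightarrow> M = N"
    using countable_determining_family by blast
  have e_cont: "continuous_on UNIV (e n)" for n
    using e_lip[of n] lipschitz_continuous by blast
  have int: "integrable \<pi> f" if "\<pi> \<in> K" "continuous_on UNIV f" for \<pi> and f :: "'z \<Rightarrow> real"
    using integrable_continuous[OF that(2)] prob[OF that(1)] by blast
  have int_mono: "integral\<^sup>L \<pi> (ap c) \<le> integral\<^sup>L \<pi> (ap c') + D c c'"
    if "\<pi> \<in> K" "c \<in> S" "c' \<in> S" for \<pi> c c'
  proof -
    interpret prob_space \<pi> using prob that(1) by blast
    have "\<bar>integral\<^sup>L \<pi> (ap c) - integral\<^sup>L \<pi> (ap c')\<bar> \<le> D c c'"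
      using that dist by (intro abs_integral_diff_le int cont) auto
    then show ?thesis by linarith
  qed
  have e_int: "0 \<le> integral\<^sup>L \<pi> (e n)" "integral\<^sup>L \<pi> (e n) \<le> 1" if "\<pi> \<in> K" for \<pi> n
  proof -
    interpret prob_space \<pi> using prob that by blast
    show "0 \<le> integral\<^sup>L \<pi> (e n)" "integral\<^sup>L \<pi> (e n) \<le> 1"
      using e int[OF that e_cont] by (auto intro!: integral_ge_const integral_le_const)
  qed
  have minimizer: "\<exists>\<pi>\<in>K. \<forall>\<pi>'\<in>K. integral\<^sup>L \<pi> (ap c) \<le> integral\<^sup>L \<pi>' (ap c)" if "c \<in> S" for c
    by (rule weak_limit_minimizer[of K "ap c"]) (use prob ne weakly_closed cont[OF that] in blast)+
  define small where "small n k c t \<longleftrightarrow> (\<exists>\<pi>\<in>K. integral\<^sup>L \<pi> (ap c) < t) \<and>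
      (\<forall>\<pi>\<in>K. \<forall>\<pi>'\<in>K. integral\<^sup>L \<pi> (ap c) < t \<longrightarrow> integral\<^sup>L \<pi>' (ap c) < t \<longrightarrow>
        integral\<^sup>L \<pi> (e n) - integral\<^sup>L \<pi>' (e n) < 1 / real (Suc k))" for n k c t
  define V where "V n k = {c \<in> S. \<exists>t. small n k c t}" for n k
  have V_open: "openin S.mtopology (V n k)" for n k
    unfolding S.openin_mtopology
  proof (intro conjI allI impI)
    fix c assume "c \<in> V n k"
    then obtain t \<pi>0 where c: "c \<in> S" and t: "small n k c t"
      and \<pi>0: "\<pi>0 \<in> K" "integral\<^sup>L \<pi>0 (ap c) < t"
      unfolding V_def small_def by blast
    \<comment> \<open>Half of the slack of \<open>\<pi>0\<close>. Moving the cost by less than this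
      changes every integral by less than it, so at the level \<open>t - \<epsilon>\<close> the new
      sublevel set still contains \<open>\<pi>0\<close> and lies inside the old one at level
      \<open>t\<close>.\<close>
    define \<epsilon> where "\<epsilon> = (t - integral\<^sup>L \<pi>0 (ap c)) / 2"
    have "S.mball c \<epsilon> \<subseteq> V n k"
    proof
      fix c' assume "c' \<in> S.mball c \<epsilon>"
      then have c': "c' \<in> S" "D c c' < \<epsilon>" by auto
      have "integral\<^sup>L \<pi>0 (ap c') < t - \<epsilon>"
        using int_mono[OF \<pi>0(1) c'(1) c] c'(2) S.commute[of c c']
        unfolding \<epsilon>_def by (simp add: field_simps)
      moreover have "integral\<^sup>L \<pi> (ap c) < t" if "\<pi> \<in> K" "integral\<^sup>L \<pi> (ap c') < t - \<epsilon>" for \<pi>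
        using int_mono[OF that(1) c c'(1)] that(2) c'(2) by linarith
      ultimately have "small n k c' (t - \<epsilon>)"
        using t \<pi>0(1) unfolding small_def by blast
      then show "c' \<in> V n k" using c' by (auto simp: V_def)
    qed
    then show "\<exists>r>0. S.mball c r \<subseteq> V n k" using \<pi>0(2) by (auto simp: \<epsilon>_def intro!: exI[of _ \<epsilon>])
  qed (simp add: V_def)
  have V_dense: "\<exists>c'\<in>V n k. D c c' < \<epsilon>" if c: "c \<in> S" and "\<epsilon> > 0" for n k c \<epsilon>
  proof (rule ccontr)
    assume none: "\<not> (\<exists>c'\<in>V n k. D c c' < \<epsilon>)"
    obtain L where "0 \<le> L" "\<And>z w. \<bar>e n z - e n w\<bar> \<le> L * d z w" using e_lip by blast
    then obtain T where T: "T > 0" and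
      "\<forall>t\<in>{0..T}. \<exists>c'\<in>S. D c c' < \<epsilon> \<and> ap c' = (\<lambda>z. ap c z + t * e n z)"
      using perturb[OF c, of "e n" L \<epsilon>] e \<open>\<epsilon> > 0\<close> by blast
    then obtain C where C: "\<And>t. t \<in> {0..T} \<Longrightarrow> C t \<in> S \<and> D c (C t) < \<epsilon> \<and>
        ap (C t) = (\<lambda>z. ap c z + t * e n z)"
      by metis
    \<comment> \<open>A grid of step \<open>\<tau>\<close> in \<open>[0, T]\<close>. The forbidden
      spread is \<open>2 * \<eta>\<close>, the tolerance \<open>\<delta>\<close> loses at most
      \<open>\<eta>\<close> per step, and \<open>N\<close> steps with net drop \<open>\<eta>\<close>
      use up the whole range [0,1] of integrals of \<open>e n\<close>.\<close>
    define N where "N = 2 * Suc k"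
    define \<tau> where "\<tau> = T / real N"
    define \<eta> where "\<eta> = 1 / (2 * real (Suc k))"
    define \<delta> where "\<delta> = \<tau> * \<eta> / 2"
    have \<eta>: "\<eta> > 0" "1 / real (Suc k) = 2 * \<eta>" "real N * \<eta> = 1"
      by (simp_all add: \<eta>_def N_def field_simps)
    have N: "real N > 0" by (simp add: N_def)
    have "\<tau> > 0" using T N by (simp add: \<tau>_def)
    then have "\<delta> > 0" using \<eta>(1) by (simp add: \<delta>_def)
    have range: "real i * \<tau> \<in> {0..T}" if "i \<le> N" for i
      using that T N by (auto simp: \<tau>_def divide_le_eq field_simps)
    define J where "J i \<pi> = integral\<^sup>L \<pi> (ap (C (real i * \<tau>)))" for i \<pi>
    have J: "J i \<pi> = integral\<^sup>L \<pi> (ap c) + real i * \<tau> * integral\<^sup>L \<pi> (e n)"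
      if "i \<le> N" "\<pi> \<in> K" for i \<pi>
      using C[OF range[OF that(1)]] int[OF that(2) cont[OF c]] int[OF that(2) e_cont]
      by (simp add: J_def)
    define spread where "spread i \<pi> \<pi>' \<longleftrightarrow> \<pi> \<in> K \<and> \<pi>' \<in> K \<and>
        (\<forall>\<rho>\<in>K. J i \<pi> \<le> J i \<rho> + \<delta> \<and> J i \<pi>' \<le> J i \<rho> + \<delta>) \<and>
        2 * \<eta> \<le> integral\<^sup>L \<pi> (e n) - integral\<^sup>L \<pi>' (e n)" for i \<pi> \<pi>'
    have "\<exists>\<pi> \<pi>'. spread i \<pi> \<pi>'" if "i \<le> N" for i
    proof -
      note Ci = C[OF range[OF that]]
      obtain \<pi>0 where \<pi>0: "\<pi>0 \<in> K" "\<And>\<rho>. \<rho> \<in> K \<Longrightarrow> J i \<pi>0 \<le> J i \<rho>"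
        using minimizer[of "C (real i * \<tau>)"] Ci unfolding J_def by blast
      \<comment> \<open>Just above the minimum the sublevel set contains \<open>\<pi>0\<close>, so
        \<open>small\<close> can fail only through two near-minimizers whose
        \<open>e n\<close>-integrals are far apart.\<close>
      have "\<not> small n k (C (real i * \<tau>)) (J i \<pi>0 + \<delta>)"
        using none Ci unfolding V_def by blast
      moreover have "J i \<pi>0 < J i \<pi>0 + \<delta>" using \<open>\<delta> > 0\<close> by simp
      ultimately obtain \<pi> \<pi>' where "\<pi> \<in> K" "\<pi>' \<in> K" "J i \<pi> < J i \<pi>0 + \<delta>" "J i \<pi>' < J i \<pi>0 + \<delta>"
        "\<not> integral\<^sup>L \<pi> (e n) - integral\<^sup>L \<pi>' (e n) < 1 / real (Suc k)"
        using \<pi>0(1) unfolding small_def J_def[symmetric] by blast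
      then show ?thesis using \<pi>0(2) unfolding spread_def \<eta>(2) by (intro exI[of _ \<pi>] exI[of _ \<pi>']) force
    qed
    then obtain P P' where "\<And>i. i \<le> N \<Longrightarrow> spread i (P i) (P' i)" by metis
    then have P: "P i \<in> K" "P' i \<in> K"
      "\<And>\<rho>. \<rho> \<in> K \<Longrightarrow> J i (P i) \<le> J i \<rho> + \<delta>"
      "\<And>\<rho>. \<rho> \<in> K \<Longrightarrow> J i (P' i) \<le> J i \<rho> + \<delta>"
      "2 * \<eta> \<le> integral\<^sup>L (P i) (e n) - integral\<^sup>L (P' i) (e n)" if "i \<le> N" for i
      using that unfolding spread_def by blast+
    define x where "x i = integral\<^sup>L (P i) (e n)" for i
    have step: "x (Suc i) \<le> x i - \<eta>" if "Suc i \<le> N" for i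
    proof -
      have i: "i \<le> N" using that by simp
      let ?y = "integral\<^sup>L (P' i) (e n)"
      \<comment> \<open>Adding the two near-minimality inequalities cancels the integrals of
        \<open>c\<close> and leaves the increment \<open>\<tau>\<close> times the integrals of
        \<open>e n\<close>: a near-minimizer at the next grid point cannot exceed the lower one,
        \<open>P' i\<close>, by more than \<open>\<eta>\<close>, while \<open>P' i\<close> lies at
        least \<open>2 * \<eta>\<close> below \<open>P i\<close>.\<close>
      have "J (Suc i) (P (Suc i)) \<le> J (Suc i) (P' i) + \<delta>" using P that i by blast
      moreover have "J i (P' i) \<le> J i (P (Suc i)) + \<delta>" using P that i by blast
      ultimately have "\<tau> * x (Suc i) \<le> \<tau> * ?y + 2 * \<delta>"
        using P(1)[OF that] P(2)[OF i] that i by (simp add: J x_def algebra_simps)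
      also have "\<dots> = \<tau> * (?y + \<eta>)"
        by (simp add: \<delta>_def field_simps)
      finally have "x (Suc i) \<le> ?y + \<eta>" using \<open>\<tau> > 0\<close> by simp
      then show ?thesis using P(5)[OF i] unfolding x_def by linarith
    qed
    have descent: "x i \<le> x 0 - real i * \<eta>" if "i \<le> N" for i
      using that
    proof (induction i)
      case (Suc i)
      then show ?case using step[of i] by (simp add: distrib_right)
    qed simp
    \<comment> \<open>After \<open>N\<close> steps even the upper integral is at most 0, so the
      lower one at the same grid point would be negative.\<close>
    have "x N \<le> 0" using descent[of N] \<eta>(3) e_int(2)[OF P(1)[of 0], of n] by (simp add: x_def)
    moreover have "integral\<^sup>L (P' N) (e n) \<ge> 0" by (rule e_int(1)[OF P(2)]) simp
    ultimately show False using P(5)[of N] \<eta>(1) unfolding x_def by linarith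
  qed
  define U where "U i = (case prod_decode i of (n, k) \<Rightarrow> V n k)" for i
  show ?thesis
    unfolding generic_in_def S.topspace_mtopology
  proof (intro conjI exI[of _ U] allI)
    show "openin S.mtopology (U i)" for i
      using V_open by (simp add: U_def split: prod.split)
    show "S.mtopology closure_of U i = S" for i
    proof
      show "S \<subseteq> S.mtopology closure_of U i"
      proof
        fix c assume c: "c \<in> S"
        then show "c \<in> S.mtopology closure_of U i"
          using V_dense[OF c] by (fastforce simp: S.metric_closure_of U_def V_def split: prod.split)
      qed
    qed (use closure_of_subset_topspace[of S.mtopology "U i"] in simp)
    show "(\<Inter>i. U i) \<subseteq> {c \<in> S. \<exists>!\<pi>. \<pi> \<in> K \<and>
        integral\<^sup>L \<pi> (ap c) = (INF \<pi>'\<in>K. integral\<^sup>L \<pi>' (ap c))}"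
    proof
      fix c assume "c \<in> (\<Inter>i. U i)"
      then have "c \<in> U (prod_encode (n, k))" for n k by blast
      then have V: "c \<in> V n k" for n k by (simp add: U_def)
      then have c: "c \<in> S" by (simp add: V_def)
      obtain \<pi> where \<pi>: "\<pi> \<in> K" "\<And>\<pi>'. \<pi>' \<in> K \<Longrightarrow> integral\<^sup>L \<pi> (ap c) \<le> integral\<^sup>L \<pi>' (ap c)"
        using minimizer[OF c] by blast
      have Inf: "(INF \<pi>'\<in>K. integral\<^sup>L \<pi>' (ap c)) = integral\<^sup>L \<pi> (ap c)"
        using \<pi> by (intro cInf_eq_minimum) auto
      \<comment> \<open>Every minimizer lies in every nonempty sublevel set, so the
        \<open>e n\<close>-integrals of two minimizers differ by less than 1/(k+1) for all
        \<open>k\<close>.\<close>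
      have "\<pi>' = \<pi>" if \<pi>': "\<pi>' \<in> K" "integral\<^sup>L \<pi>' (ap c) = integral\<^sup>L \<pi> (ap c)" for \<pi>'
      proof (rule determining)
        fix n
        have "\<bar>integral\<^sup>L \<pi>' (e n) - integral\<^sup>L \<pi> (e n)\<bar> < 1 / real (Suc k)" for k
        proof -
          obtain t where t: "small n k c t" using V[of n k] by (auto simp: V_def)
          then have "integral\<^sup>L \<pi> (ap c) < t" using \<pi>(2) unfolding small_def by force
          then show ?thesis using t \<pi>(1) \<pi>' unfolding small_def abs_less_iff by force
        qed
        then show "integral\<^sup>L \<pi>' (e n) = integral\<^sup>L \<pi> (e n)"
          using reals_Archimedean[of "\<bar>integral\<^sup>L \<pi>' (e n) - integral\<^sup>L \<pi> (e n)\<bar>"]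
          unfolding inverse_eq_divide by (meson order.asym zero_less_abs_iff eq_iff_diff_eq_0)
      qed (use prob \<pi> \<pi>' in auto)
      then show "c \<in> {c \<in> S. \<exists>!\<pi>. \<pi> \<in> K \<and>
          integral\<^sup>L \<pi> (ap c) = (INF \<pi>'\<in>K. integral\<^sup>L \<pi>' (ap c))}"
        using c \<pi>(1) Inf by auto
    qed
  qed auto
qed

end

section \<open>Plans with shift-invariant marginal\<close>

lemma compact_metric_type_sum_dist:
  assumes "0 < l" "l < 1" "compact (UNIV :: 'x::metric_space set)"
  shows "compact_metric_type
    (sum_dist l :: 'x \<times> (nat \<Rightarrow> 'd::{finite,discrete_topology}) \<Rightarrow> _)"
  using assms
  by (intro compact_metric_type.intro compact_metric_type_axioms.intro Metric_space_sum_dist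
      mtopology_sum_dist compact_UNIV_prod)

lemma continuous_shift: "continuous_on UNIV (shift :: (nat \<Rightarrow> 'd::topological_space) \<Rightarrow> _)"
  unfolding shift_def
  by (intro continuous_on_coordinatewise_then_product continuous_on_product_coordinates)

text \<open>A constant sequence is a fixed point of the shift, so the product of
  \<open>\<mu>\<close> with the Dirac mass there is a plan.\<close>

lemma invariant_plans_nonempty:
  fixes \<mu> :: "'x::metric_space measure"
  assumes "sets \<mu> = sets borel" "prob_space \<mu>"
  shows "(invariant_plans \<mu> ::
    ('x \<times> (nat \<Rightarrow> 'd::{finite,discrete_topology})) measure set) \<noteq> {}"
proof -
  define y :: "nat \<Rightarrow> 'd" where "y = (\<lambda>_. undefined)"
  have shift_y: "shift y = y" by (simp add: y_def shift_def)
  have meas: "f \<in> measurable \<mu> borel" if "continuous_on UNIV f" for f :: "'x \<Rightarrow> 'b::topological_space"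
    using borel_measurable_continuous_onI[OF that] measurable_cong_sets[OF assms(1) refl] by blast
  have pair: "(\<lambda>x. (x, y)) \<in> measurable \<mu> borel"
    by (intro meas continuous_intros)
  have const: "(\<lambda>x. y) \<in> measurable \<mu> borel" by simp
  have fst_meas: "fst \<in> measurable borel (borel :: 'x measure)"
    and snd_meas: "snd \<in> measurable borel (borel :: (nat \<Rightarrow> 'd) measure)"
    by (intro borel_measurable_continuous_onI continuous_intros)+
  have snd: "distr (distr \<mu> borel (\<lambda>x. (x, y))) borel snd = distr \<mu> borel (\<lambda>x. y)"
    using distr_distr[OF snd_meas pair] by (simp add: comp_def)
  have "distr \<mu> borel (\<lambda>x. (x, y)) \<in> invariant_plans \<mu>"
    unfolding invariant_plans_def
  proof (intro CollectI conjI)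
    show "prob_space (distr \<mu> borel (\<lambda>x. (x, y)))"
      by (rule prob_space.prob_space_distr[OF assms(2) pair])
    show "distr (distr \<mu> borel (\<lambda>x. (x, y))) borel fst = \<mu>"
      using distr_distr[OF fst_meas pair] assms(1) by (simp add: comp_def distr_id2)
    show "distr (distr (distr \<mu> borel (\<lambda>x. (x, y))) borel snd) borel shift =
        distr (distr \<mu> borel (\<lambda>x. (x, y))) borel snd"
      unfolding snd using distr_distr[OF borel_measurable_continuous_onI[OF continuous_shift] const]
      by (simp add: comp_def shift_y)
  qed simp
  then show ?thesis by blast
qed

text \<open>
  Both marginal conditions are tested on the product itself, by embedding \<open>X\<close> and \<open>Y\<close> as slices
  \<open>X \<times> {y}\<close> and \<open>{x} \<times> Y\<close>.
\<close>

lemma invariant_plans_weakly_closed: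
  fixes \<mu> :: "'x::metric_space measure"
    and \<rho> :: "nat \<Rightarrow> ('x \<times> (nat \<Rightarrow> 'd::{finite,discrete_topology})) measure"
  assumes X: "compact (UNIV :: 'x set)" and \<mu>: "sets \<mu> = sets borel" "prob_space \<mu>"
    and \<rho>: "\<And>j. \<rho> j \<in> invariant_plans \<mu>"
    and \<pi>: "prob_space \<pi>" "sets \<pi> = sets borel"
    and lim: "\<And>f :: _ \<Rightarrow> real. continuous_on UNIV f \<Longrightarrow>
      (\<lambda>j. integral\<^sup>L (\<rho> j) f) \<longlonglongrightarrow> integral\<^sup>L \<pi> f"
  shows "\<pi> \<in> invariant_plans \<mu>"
proof -
  \<comment> \<open>The claim is purely topological, so the rate 1/2 is an arbitrary choice from
    (0,1).\<close>
  interpret compact_metric_type "sum_dist (1 / 2) :: 'x \<times> (nat \<Rightarrow> 'd) \<Rightarrow> _"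
    by (rule compact_metric_type_sum_dist) (use X in auto)
  obtain e :: "nat \<Rightarrow> 'x \<times> (nat \<Rightarrow> 'd) \<Rightarrow> real"
    where "\<And>n z. 0 \<le> e n z" "\<And>n z. e n z \<le> 1"
    and e_lip: "\<And>n. \<exists>L\<ge>0. \<forall>z w. \<bar>e n z - e n w\<bar> \<le> L * sum_dist (1 / 2) z w"
    and determining: "\<And>M N. \<lbrakk>prob_space M; sets M = sets borel; prob_space N; sets N = sets borel;
      \<And>n. integral\<^sup>L M (e n) = integral\<^sup>L N (e n)\<rbrakk> \<Longrightarrow> M = N"
    using countable_determining_family by blast
  have e_cont: "continuous_on UNIV (e n)" for n
    using e_lip[of n] lipschitz_continuous by blast
  have e_meas: "e n \<in> borel_measurable borel" for n
    by (rule borel_measurable_continuous_onI[OF e_cont])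
  define x0 :: 'x where "x0 = undefined"
  define y0 :: "nat \<Rightarrow> 'd" where "y0 = undefined"
  have meas: "f \<in> measurable M borel" if "continuous_on UNIV f" "sets M = sets borel"
    for f :: "'a::topological_space \<Rightarrow> 'b::topological_space" and M
    using borel_measurable_continuous_onI[OF that(1)] measurable_cong_sets[OF that(2) refl] by blast
  have e_comp: "continuous_on UNIV (\<lambda>z. e n (h z))" if "continuous_on UNIV h"
    for n and h :: "'a::topological_space \<Rightarrow> 'x \<times> (nat \<Rightarrow> 'd)"
    using continuous_on_compose2[OF e_cont that] by simp
  have \<rho>': "sets (\<rho> j) = sets borel" "distr (\<rho> j) borel fst = \<mu>"
    "distr (distr (\<rho> j) borel snd) borel shift = distr (\<rho> j) borel snd" for j
    using \<rho>[of j] by (auto simp: invariant_plans_def)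
  note shift_cont = continuous_shift[where 'd = 'd]
  have fst_cont: "continuous_on UNIV (fst :: 'x \<times> (nat \<Rightarrow> 'd) \<Rightarrow> _)"
    and snd_cont: "continuous_on UNIV (snd :: 'x \<times> (nat \<Rightarrow> 'd) \<Rightarrow> _)"
    by (intro continuous_intros)+
  have slice_x: "continuous_on UNIV (\<lambda>x :: 'x. (x, y0))"
    and slice_y: "continuous_on UNIV (\<lambda>y :: nat \<Rightarrow> 'd. (x0, y))"
    by (intro continuous_intros)+
  have slice_fst: "continuous_on UNIV (\<lambda>z :: 'x \<times> (nat \<Rightarrow> 'd). (fst z, y0))"
    and slice_snd: "continuous_on UNIV (\<lambda>z :: 'x \<times> (nat \<Rightarrow> 'd). (x0, snd z))"
    by (intro continuous_intros)+
  have shift_snd: "continuous_on UNIV (\<lambda>z :: 'x \<times> (nat \<Rightarrow> 'd). shift (snd z))"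
    using continuous_on_compose2[OF shift_cont snd_cont] by simp
  then have slice_shift: "continuous_on UNIV (\<lambda>z :: 'x \<times> (nat \<Rightarrow> 'd). (x0, shift (snd z)))"
    by (intro continuous_on_Pair continuous_on_const)
  have fst_marginal: "distr \<pi> borel (\<lambda>z. (fst z, y0)) = distr \<mu> borel (\<lambda>x. (x, y0))"
  proof (rule determining)
    show "prob_space (distr \<pi> borel (\<lambda>z. (fst z, y0)))"
      by (rule prob_space.prob_space_distr[OF \<pi>(1) meas[OF slice_fst \<pi>(2)]])
    show "prob_space (distr \<mu> borel (\<lambda>x. (x, y0)))"
      by (rule prob_space.prob_space_distr[OF \<mu>(2) meas[OF slice_x \<mu>(1)]])
    fix n
    have "(\<integral>z. e n (fst z, y0) \<partial>\<rho> j) = (\<integral>x. e n (x, y0) \<partial>\<mu>)" for j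
      unfolding \<rho>'(2)[of j, symmetric]
      by (rule integral_distr[symmetric])
        (auto intro!: meas fst_cont \<rho>' e_comp slice_x)
    then have "(\<integral>z. e n (fst z, y0) \<partial>\<pi>) = (\<integral>x. e n (x, y0) \<partial>\<mu>)"
      using lim[OF e_comp[OF slice_fst, of n]] by (simp add: LIMSEQ_const_iff)
    then show "integral\<^sup>L (distr \<pi> borel (\<lambda>z. (fst z, y0))) (e n) =
        integral\<^sup>L (distr \<mu> borel (\<lambda>x. (x, y0))) (e n)"
      by (simp add: integral_distr[OF meas[OF slice_fst \<pi>(2)] e_meas]
          integral_distr[OF meas[OF slice_x \<mu>(1)] e_meas])
  qed simp_all
  have snd_marginal: "distr \<pi> borel (\<lambda>z. (x0, shift (snd z))) = distr \<pi> borel (\<lambda>z. (x0, snd z))"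
  proof (rule determining)
    show "prob_space (distr \<pi> borel (\<lambda>z. (x0, shift (snd z))))"
      by (rule prob_space.prob_space_distr[OF \<pi>(1) meas[OF slice_shift \<pi>(2)]])
    show "prob_space (distr \<pi> borel (\<lambda>z. (x0, snd z)))"
      by (rule prob_space.prob_space_distr[OF \<pi>(1) meas[OF slice_snd \<pi>(2)]])
    fix n
    have "(\<integral>z. e n (x0, shift (snd z)) \<partial>\<rho> j) = (\<integral>z. e n (x0, snd z) \<partial>\<rho> j)" for j
    proof -
      have ey: "(\<lambda>y. e n (x0, y)) \<in> borel_measurable borel"
        by (rule meas[OF e_comp[OF slice_y]]) simp
      have "(\<integral>z. e n (x0, shift (snd z)) \<partial>\<rho> j) =
          (\<integral>y. e n (x0, shift y) \<partial>distr (\<rho> j) borel snd)"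
        by (rule integral_distr[symmetric, OF meas[OF snd_cont \<rho>'(1)]])
          (rule measurable_compose[OF meas[OF shift_cont refl] ey])
      also have "\<dots> = (\<integral>y. e n (x0, y) \<partial>distr (distr (\<rho> j) borel snd) borel shift)"
        by (rule integral_distr[symmetric, OF meas[OF shift_cont] ey]) simp
      also have "\<dots> = (\<integral>z. e n (x0, snd z) \<partial>\<rho> j)"
        unfolding \<rho>'(3) by (rule integral_distr[OF meas[OF snd_cont \<rho>'(1)] ey])
      finally show ?thesis .
    qed
    then have "(\<integral>z. e n (x0, shift (snd z)) \<partial>\<pi>) = (\<integral>z. e n (x0, snd z) \<partial>\<pi>)"
      using LIMSEQ_unique[OF lim[OF e_comp[OF slice_shift, of n]]]
        lim[OF e_comp[OF slice_snd, of n]] by simp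
    then show "integral\<^sup>L (distr \<pi> borel (\<lambda>z. (x0, shift (snd z)))) (e n) =
        integral\<^sup>L (distr \<pi> borel (\<lambda>z. (x0, snd z))) (e n)"
      by (simp add: integral_distr[OF meas[OF slice_shift \<pi>(2)] e_meas]
          integral_distr[OF meas[OF slice_snd \<pi>(2)] e_meas])
  qed simp_all
  \<comment> \<open>The slice embeddings have the projections as left inverses, so projecting the
    identities between slice measures returns the marginals themselves.\<close>
  have "distr \<pi> borel fst = distr (distr \<pi> borel (\<lambda>z. (fst z, y0))) borel fst"
    using distr_distr[OF meas[OF fst_cont refl] meas[OF slice_fst \<pi>(2)]] by (simp add: comp_def)
  also have "\<dots> = \<mu>"
    unfolding fst_marginal
    using distr_distr[OF meas[OF fst_cont refl] meas[OF slice_x \<mu>(1)]] \<mu>(1)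
    by (simp add: comp_def distr_id2)
  finally have "distr \<pi> borel fst = \<mu>" .
  moreover have "distr (distr \<pi> borel snd) borel shift = distr \<pi> borel snd"
  proof -
    have "distr (distr \<pi> borel snd) borel shift = distr \<pi> borel (\<lambda>z. shift (snd z))"
      using distr_distr[OF meas[OF shift_cont refl] meas[OF snd_cont \<pi>(2)]] by (simp add: comp_def)
    also have "\<dots> = distr (distr \<pi> borel (\<lambda>z. (x0, shift (snd z)))) borel snd"
      using distr_distr[OF meas[OF snd_cont refl] meas[OF slice_shift \<pi>(2)]] by (simp add: comp_def)
    also have "\<dots> = distr \<pi> borel snd"
      unfolding snd_marginal
      using distr_distr[OF meas[OF snd_cont refl] meas[OF slice_snd \<pi>(2)]] by (simp add: comp_def)
    finally show ?thesis .
  qed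
  ultimately show ?thesis using \<pi> by (simp add: invariant_plans_def)
qed

section \<open>Perturbation estimates in the Lipschitz norm\<close>

text \<open>The perturbation contributes at most \<open>t\<close> to the uniform part of the norm
  and at most \<open>t * L\<close> to the Lipschitz part. This provides the small perturbations that
  \<open>generic_unique_minimizer\<close> asks for.\<close>

lemma lip_dist_scaled_le:
  fixes c g :: "'x::metric_space \<times> (nat \<Rightarrow> 'd) \<Rightarrow> real"
  assumes "c \<in> lip_funs l" "L \<in> lip_bounds l g" "\<And>z. \<bar>g z\<bar> \<le> 1" "0 \<le> t"
  shows "(\<lambda>z. c z + t * g z) \<in> lip_funs l"
    and "lip_dist l c (\<lambda>z. c z + t * g z) \<le> t * (1 + L)"
proof -
  have tL: "t * L \<in> lip_bounds l (\<lambda>z. t * g z)"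
  proof -
    have "\<bar>t * g p - t * g q\<bar> \<le> t * L * sum_dist l p q" for p q
    proof -
      have "\<bar>t * g p - t * g q\<bar> = t * \<bar>g p - g q\<bar>"
        using assms(4) by (simp add: abs_mult flip: right_diff_distrib)
      also have "\<dots> \<le> t * (L * sum_dist l p q)"
        using assms(2,4) unfolding lip_bounds_def by (intro mult_left_mono) blast+
      finally show ?thesis by (simp add: mult.assoc)
    qed
    then show ?thesis using assms by (simp add: lip_bounds_def)
  qed
  show c': "(\<lambda>z. c z + t * g z) \<in> lip_funs l"
    using assms(1) lip_bounds_add[OF _ tL] by (auto simp: lip_funs_def)
  have "lip_dist l c (\<lambda>z. c z + t * g z) = (SUP z. \<bar>t * g z\<bar>) + Lip l (\<lambda>z. - (t * g z))"
    using assms(1) c' by (simp add: lip_dist_def lip_norm_def)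
  also have "\<dots> \<le> t + t * L"
  proof (rule add_mono)
    show "(SUP z. \<bar>t * g z\<bar>) \<le> t"
      using assms(3,4) by (intro cSUP_least) (auto simp: abs_mult intro: mult_left_le)
    show "Lip l (\<lambda>z. - (t * g z)) \<le> t * L"
      using tL by (intro Lip_le) (simp only: lip_bounds_uminus)
  qed
  finally show "lip_dist l c (\<lambda>z. c z + t * g z) \<le> t * (1 + L)" by (simp add: algebra_simps)
qed

lemma abs_diff_le_lip_dist:
  fixes c c' :: "'x::metric_space \<times> (nat \<Rightarrow> 'd) \<Rightarrow> real"
  assumes "0 < l" "l < 1" "compact (UNIV :: 'x set)" "c \<in> lip_funs l" "c' \<in> lip_funs l"
  shows "\<bar>c p - c' p\<bar> \<le> lip_dist l c c'"
proof -
  note d = lip_funs_diff[OF assms(4,5)]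
  have "\<bar>c p - c' p\<bar> \<le> (SUP p. \<bar>c p - c' p\<bar>)"
    using bdd_above_lip_fun[OF assms(1-3) d] by (intro cSUP_upper) auto
  moreover have "0 \<le> Lip l (\<lambda>p. c p - c' p)"
    using Lip_in_lip_bounds[OF assms(1) d] by (simp add: lip_bounds_def)
  ultimately show ?thesis using assms(4,5) by (simp add: lip_dist_def lip_norm_def)
qed

section \<open>Generic uniqueness in the cone of nonnegative costs and in the Lipschitz
  space\<close>

theorem theorem9:
  fixes \<mu> :: "'x::metric_space measure" and l :: real
  assumes "compact (UNIV :: 'x set)"
    and "sets \<mu> = sets borel" and "prob_space \<mu>"
    and "0 < l" and "l < 1"
  shows "generic_in (top_of_set nonneg_cont)
      {c :: ('x \<times> (nat \<Rightarrow> 'd::{finite,discrete_topology})) \<Rightarrow>\<^sub>C real.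
        c \<in> nonneg_cont \<and> (\<exists>!\<pi>. optimal_plan \<mu> (apply_bcontfun c) \<pi>)} \<and>
    generic_in (lip_topology l)
      {c :: 'x \<times> (nat \<Rightarrow> 'd) \<Rightarrow> real.
        c \<in> lip_funs l \<and> (\<exists>!\<pi>. optimal_plan \<mu> c \<pi>)}"
proof
  interpret compact_metric_type "sum_dist l :: 'x \<times> (nat \<Rightarrow> 'd) \<Rightarrow> _"
    by (rule compact_metric_type_sum_dist) (use assms in auto)
  let ?K = "invariant_plans \<mu> :: ('x \<times> (nat \<Rightarrow> 'd)) measure set"
  have prob: "\<And>\<pi>. \<pi> \<in> ?K \<Longrightarrow> prob_space \<pi> \<and> sets \<pi> = sets borel"
    by (simp add: invariant_plans_def)
  note ne = invariant_plans_nonempty[OF assms(2,3), where 'd = 'd]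
  note generic = generic_unique_minimizer[OF prob ne
      invariant_plans_weakly_closed[OF assms(1-3)], folded optimal_plan_def]
  show "generic_in (top_of_set nonneg_cont)
      {c :: ('x \<times> (nat \<Rightarrow> 'd)) \<Rightarrow>\<^sub>C real.
        c \<in> nonneg_cont \<and> (\<exists>!\<pi>. optimal_plan \<mu> (apply_bcontfun c) \<pi>)}"
  proof -
    let ?S = "nonneg_cont :: (('x \<times> (nat \<Rightarrow> 'd)) \<Rightarrow>\<^sub>C real) set"
    interpret S: Submetric UNIV dist ?S
      by unfold_locales auto
    have "generic_in S.sub.mtopology
        {c \<in> ?S. \<exists>!\<pi>. optimal_plan \<mu> (apply_bcontfun c) \<pi>}"
    proof (rule generic)
      show "Metric_space ?S dist" by (rule S.sub.Metric_space_axioms)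
      show "continuous_on UNIV (apply_bcontfun c)" for c :: "('x \<times> (nat \<Rightarrow> 'd)) \<Rightarrow>\<^sub>C real"
        by (rule continuous_on_apply_bcontfun)
      show "\<bar>apply_bcontfun c z - apply_bcontfun c' z\<bar> \<le> dist c c'"
        for c c' :: "('x \<times> (nat \<Rightarrow> 'd)) \<Rightarrow>\<^sub>C real" and z
        using dist_bounded[of c z c'] by (simp add: dist_real_def)
      fix c :: "('x \<times> (nat \<Rightarrow> 'd)) \<Rightarrow>\<^sub>C real" and g :: "'x \<times> (nat \<Rightarrow> 'd) \<Rightarrow> real" and L \<epsilon> :: real
      assume c: "c \<in> ?S" and g: "\<And>z. 0 \<le> g z" "\<And>z. g z \<le> 1"
        "\<And>z w. \<bar>g z - g w\<bar> \<le> L * sum_dist l z w" and "\<epsilon> > 0"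
      have "\<exists>c'\<in>?S. dist c c' < \<epsilon> \<and> apply_bcontfun c' = (\<lambda>z. apply_bcontfun c z + t * g z)"
        if t: "t \<in> {0..\<epsilon> / 2}" for t
      proof -
        define c' where "c' = Bcontfun (\<lambda>z. apply_bcontfun c z + t * g z)"
        have c': "apply_bcontfun c' = (\<lambda>z. apply_bcontfun c z + t * g z)"
          unfolding c'_def using lipschitz_continuous[OF g(3)]
          by (intro Bcontfun_inverse continuous_in_bcontfun assms(1) continuous_intros) auto
        \<comment> \<open>Nonnegativity of both \<open>t\<close> and \<open>g\<close> keeps the
          perturbed cost in the cone.\<close>
        have "c' \<in> ?S" using c g t by (auto simp: nonneg_cont_def c')
        moreover have "dist c c' \<le> t"
          using g t by (intro dist_bound) (auto simp: c' dist_real_def abs_mult intro: mult_left_le)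
        ultimately show ?thesis using c' t \<open>\<epsilon> > 0\<close> by force
      qed
      then show "\<exists>T>0. \<forall>t\<in>{0..T}. \<exists>c'\<in>?S. dist c c' < \<epsilon> \<and>
          apply_bcontfun c' = (\<lambda>z. apply_bcontfun c z + t * g z)"
        using \<open>\<epsilon> > 0\<close> by (intro exI[of _ "\<epsilon> / 2"]) auto
    qed
    then show ?thesis by (simp add: S.mtopology_submetric)
  qed
  show "generic_in (lip_topology l)
      {c :: 'x \<times> (nat \<Rightarrow> 'd) \<Rightarrow> real.
        c \<in> lip_funs l \<and> (\<exists>!\<pi>. optimal_plan \<mu> c \<pi>)}"
    unfolding lip_topology_def
  proof (rule generic)
    show "Metric_space (lip_funs l :: ('x \<times> (nat \<Rightarrow> 'd) \<Rightarrow> real) set) (lip_dist l)"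
      by (rule Metric_space_lip_funs[OF assms(4,5,1)])
    show "continuous_on UNIV c" if "c \<in> lip_funs l" for c :: "'x \<times> (nat \<Rightarrow> 'd) \<Rightarrow> real"
      using that lipschitz_continuous by (auto simp: lip_funs_def lip_bounds_def)
    show "\<bar>c z - c' z\<bar> \<le> lip_dist l c c'"
      if "c \<in> lip_funs l" "c' \<in> lip_funs l" for c c' :: "'x \<times> (nat \<Rightarrow> 'd) \<Rightarrow> real" and z
      by (rule abs_diff_le_lip_dist[OF assms(4,5,1) that])
    fix c g :: "'x \<times> (nat \<Rightarrow> 'd) \<Rightarrow> real" and L \<epsilon> :: real
    assume c: "c \<in> lip_funs l" and g: "\<And>z. 0 \<le> g z" "\<And>z. g z \<le> 1" and L: "0 \<le> L"
      "\<And>z w. \<bar>g z - g w\<bar> \<le> L * sum_dist l z w" and "\<epsilon> > 0"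
    \<comment> \<open>The perturbation moves the cost by at most \<open>t * (1 + L)\<close>; the
      factor 2 makes the bound by \<open>\<epsilon>\<close> strict.\<close>
    define T where "T = \<epsilon> / (2 * (1 + L))"
    have T: "T > 0" "T * (1 + L) < \<epsilon>"
      using L(1) \<open>\<epsilon> > 0\<close> by (simp_all add: T_def field_simps add_pos_nonneg)
    have "\<exists>c'\<in>lip_funs l. lip_dist l c c' < \<epsilon> \<and> c' = (\<lambda>z. c z + t * g z)" if t: "t \<in> {0..T}" for t
    proof -
      have "L \<in> lip_bounds l g" using L by (simp add: lip_bounds_def)
      note scaled = lip_dist_scaled_le[OF c this, of t]
      have "t * (1 + L) \<le> T * (1 + L)" using t L(1) by (intro mult_right_mono) auto
      then show ?thesis using scaled g t T(2) by force
    qed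
    then show "\<exists>T>0. \<forall>t\<in>{0..T}. \<exists>c'\<in>lip_funs l. lip_dist l c c' < \<epsilon> \<and> c' = (\<lambda>z. c z + t * g z)"
      using T(1) by blast
  qed
qed

end
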